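(* Let $N\in\mathbb{N}$, $t\in\mathbb{R}$ and $z=x+iy$ with $|y|\le\delta\epsilon_N$. Let $E^{\min}_N(x,t):=\min_{S\subseteq\{1,\dots,N\}}E_{N,S}(x,t)$. Then $$0<\Big[d\Big(2\kappa_{\max}\tfrac{|y|}{\epsilon_N}\Big)\Big]^N\le|Z_N(z,t)|\le2^N\exp\Big(-\frac{2}{\pi\epsilon_N^2}E^{\min}_N(x,t)\Big),$$ where $d(\theta):=1$ for $0\le\theta\le\pi/2$ and $d(\theta):=\sin\theta$ for $\pi/2<\theta\le\pi$. In particular $Z_N(\cdot,t)$ has no zeros in the strip $|\operatorname{Im}z|\le\delta\epsilon_N$; moreover $Z_N(x,t)>0$ for real $x$, and with the argument of $Z_N(z,t)$ defined to be $0$ on $\mathbb{R}$ and continuous in the strip, $$0\le-\operatorname{sgn}(y)\arg Z_N(z,t)\le2N\kappa_{\max}\frac{|y|}{\epsilon_N}.$$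
   Context: Fix $\delta>0$ and an admissible initial condition $u_0$: $u_0:\mathbb{R}\to\mathbb{R}$ is $C^1$, $u_0>0$, $u_0(x)\to0$ as $x\to\pm\infty$, $\int(x^2+1)u_0<\infty$, $u_0'$ vanishes only at $x_{\max}$ where $u_0$ attains its maximum $u_{\max}$. Standing assumption: $\int_{\mathbb{R}}\sqrt{u_0}<\infty$. Lambert $W$: $W_n$ are the standard branches of the inverse of $w\mapsto we^w$; for real $a\in[-e^{-1},0)$, $W_0(a)\in[-1,0)$, $W_{-1}(a)\in(-\infty,-1]$; for real $a<-e^{-1}$, $W_0(a)$ is the solution of $we^w=a$ with $0<\operatorname{Im}w<\pi$ and $W_{-1}(a):=\overline{W_0(a)}$. $\zeta(\kappa):=\kappa\cot(2\delta\kappa)+i\kappa$ ($0<|\kappa|<\pi/(2\delta)$), $\zeta(0):=1/(2\delta)$; $E(\zeta):=-\zeta+\frac1{2\delta}(1+\operatorname{Log}(2\delta\zeta))$, real and increasing along $\kappa\mapsto\zeta(\kappa)$, $\kappa\in[0,\pi/(2\delta))$. $\zeta_{\max}:=-\frac1{2\delta}W_{-1}(-e^{2\delta u_{\max}-1})$, $\kappa_{\max}:=\operatorname{Im}\zeta_{\max}\in(0,\pi/(2\delta))$. For $\kappa\in(0,\kappa_{\max}]$, $x_-(\kappa)\le x_{\max}\le x_+(\kappa)$ solve $u_0(x)=E(\zeta(\kappa))$, $x_\pm(0)=\pm\infty$; $a(\kappa,u):=-2\delta\zeta(\kappa)e^{-2\delta(\zeta(\kappa)+u)}$ (real). $R^{\mathrm{Wyl}}(\kappa):=\frac1{4\delta}\int_{x_-(\kappa)}^{x_+(\kappa)}[W_0-W_{-1}](a(\kappa,u_0(x)))dx$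 (finite, strictly decreasing, $R^{\mathrm{Wyl}}(\kappa_{\max})=0$). $\theta_+(\kappa):=\kappa x_+(\kappa)+\int_{x_+(\kappa)}^{\infty}\operatorname{Im}[\zeta(\kappa)+\frac1{2\delta}W_{-1}(a(\kappa,u_0(x)))]dx$. Data: $\epsilon_N:=R^{\mathrm{Wyl}}(0)/(\pi N)$; $\kappa_n\in(0,\kappa_{\max})$ with $R^{\mathrm{Wyl}}(\kappa_n)=\pi(n-\frac12)\epsilon_N$, $\zeta_n:=\zeta(\kappa_n)$, $c_n:=\exp(2\theta_+(\kappa_n)/\epsilon_N)$, $1\le n\le N$. $D_N(z,t)$: diagonal with entries $c_n^{1/2}\exp(-\kappa_nz/\epsilon_N-\operatorname{Im}[(\zeta_n-\frac1{2\delta})^2]t/\epsilon_N)$; $[C_N]_{n\ell}:=i/(\zeta_\ell-\overline{\zeta_n})$; $\Delta_N:=D_NC_ND_N$; $Z_N(z,t):=\det(I_N+\Delta_N(z,t))$. Energies: $V(\kappa;z,t):=z\kappa+t\operatorname{Im}[(\zeta(\kappa)-\frac1{2\delta})^2]-\theta_+(\kappa)$; $g(\zeta,\lambda):=\log|(\zeta-\bar\lambda)/(\zeta-\lambda)|$ for $\zeta\ne\lambda$ and $g(\zeta,\zeta):=\log|\zeta-\bar\zeta|$. For $S\subseteq\{1,\dots,N\}$, $E_{N,S}(z,t):=\pi\epsilon_N\sum_{n\in S}V(\kappa_n;z,t)+\frac{\pi\epsilon_N^2}{2}\sum_{n,\ell\in S}g(\zeta_n,\zeta_\ell)$ ($E_{N,\emptyset}=0$).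 One has $Z_N(z,t)=\sum_{S}\exp(-\frac{2}{\pi\epsilon_N^2}E_{N,S}(z,t))$. *)

theory Defs
  imports "HOL-Analysis.Analysis" "Jordan_Normal_Form.Determinant"
begin

definition admissible :: "(real \<Rightarrow> real) \<Rightarrow> bool" where
  "admissible u0 \<longleftrightarrow>
     (\<forall>x. u0 differentiable at x) \<and> continuous_on UNIV (deriv u0) \<and>
     (\<forall>x. 0 < u0 x) \<and> (u0 \<longlongrightarrow> 0) at_top \<and> (u0 \<longlongrightarrow> 0) at_bot \<and>
     (\<lambda>x. (x\<^sup>2 + 1) * u0 x) integrable_on UNIV \<and>
     (\<exists>xm. (\<forall>x. u0 x \<le> u0 xm) \<and> (\<forall>x. deriv u0 x = 0 \<longrightarrow> x = xm))"

definition xmax :: "(real \<Rightarrow> real) \<Rightarrow> real" where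
  "xmax u0 = (THE x. \<forall>y. u0 y \<le> u0 x)"

definition umax :: "(real \<Rightarrow> real) \<Rightarrow> real" where
  "umax u0 = u0 (xmax u0)"

definition W0 :: "real \<Rightarrow> complex" where
  "W0 a = (if - exp (-1) \<le> a then complex_of_real (THE w::real. -1 \<le> w \<and> w * exp w = a)
           else (THE w::complex. w * exp w = complex_of_real a \<and> 0 < Im w \<and> Im w < pi))"

definition Wm1 :: "real \<Rightarrow> complex" where
  "Wm1 a = (if - exp (-1) \<le> a \<and> a < 0 then complex_of_real (THE w::real. w \<le> -1 \<and> w * exp w = a)
            else if a < - exp (-1) then cnj (W0 a) else undefined)"

definition zeta :: "real \<Rightarrow> real \<Rightarrow> complex" where
  "zeta \<delta> \<kappa> = (if \<kappa> = 0 then complex_of_real (1 / (2 * \<delta>))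
                   else complex_of_real (\<kappa> * cot (2 * \<delta> * \<kappa>)) + \<i> * complex_of_real \<kappa>)"

definition EE :: "real \<Rightarrow> complex \<Rightarrow> complex" where
  "EE \<delta> \<zeta> = - \<zeta> + complex_of_real (1 / (2 * \<delta>)) * (1 + Ln (complex_of_real (2 * \<delta>) * \<zeta>))"

text \<open>E(zeta(kappa)) is real; we use its real part.\<close>
definition Ek :: "real \<Rightarrow> real \<Rightarrow> real" where
  "Ek \<delta> \<kappa> = Re (EE \<delta> (zeta \<delta> \<kappa>))"

definition zeta_max :: "real \<Rightarrow> (real \<Rightarrow> real) \<Rightarrow> complex" where
  "zeta_max \<delta> u0 = - complex_of_real (1 / (2 * \<delta>)) * Wm1 (- exp (2 * \<delta> * umax u0 - 1))"

definition kmax :: "real \<Rightarrow> (real \<Rightarrow> real) \<Rightarrow> real" where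
  "kmax \<delta> u0 = Im (zeta_max \<delta> u0)"

definition xplus :: "real \<Rightarrow> (real \<Rightarrow> real) \<Rightarrow> real \<Rightarrow> real" where
  "xplus \<delta> u0 \<kappa> = (THE x. xmax u0 \<le> x \<and> u0 x = Ek \<delta> \<kappa>)"

definition xminus :: "real \<Rightarrow> (real \<Rightarrow> real) \<Rightarrow> real \<Rightarrow> real" where
  "xminus \<delta> u0 \<kappa> = (THE x. x \<le> xmax u0 \<and> u0 x = Ek \<delta> \<kappa>)"

text \<open>a(kappa,u) is real; we use its real part.\<close>
definition aa :: "real \<Rightarrow> real \<Rightarrow> real \<Rightarrow> real" where
  "aa \<delta> \<kappa> u = Re (- complex_of_real (2 * \<delta>) * zeta \<delta> \<kappa>
                    * exp (- complex_of_real (2 * \<delta>) * (zeta \<delta> \<kappa> + complex_of_real u)))"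

definition Rwyl :: "real \<Rightarrow> (real \<Rightarrow> real) \<Rightarrow> real \<Rightarrow> real" where
  "Rwyl \<delta> u0 \<kappa> = 1 / (4 * \<delta>) *
     Re (integral (if \<kappa> = 0 then UNIV else {xminus \<delta> u0 \<kappa> .. xplus \<delta> u0 \<kappa>})
           (\<lambda>x. W0 (aa \<delta> \<kappa> (u0 x)) - Wm1 (aa \<delta> \<kappa> (u0 x))))"

definition thetap :: "real \<Rightarrow> (real \<Rightarrow> real) \<Rightarrow> real \<Rightarrow> real" where
  "thetap \<delta> u0 \<kappa> = \<kappa> * xplus \<delta> u0 \<kappa> +
     integral {xplus \<delta> u0 \<kappa> ..}
       (\<lambda>x. Im (zeta \<delta> \<kappa> + Wm1 (aa \<delta> \<kappa> (u0 x)) / complex_of_real (2 * \<delta>)))"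

definition epsN :: "real \<Rightarrow> (real \<Rightarrow> real) \<Rightarrow> nat \<Rightarrow> real" where
  "epsN \<delta> u0 N = Rwyl \<delta> u0 0 / (pi * real N)"

definition kap :: "real \<Rightarrow> (real \<Rightarrow> real) \<Rightarrow> nat \<Rightarrow> nat \<Rightarrow> real" where
  "kap \<delta> u0 N n = (THE \<kappa>. 0 < \<kappa> \<and> \<kappa> < kmax \<delta> u0 \<and>
                       Rwyl \<delta> u0 \<kappa> = pi * (real n - 1/2) * epsN \<delta> u0 N)"

definition zn :: "real \<Rightarrow> (real \<Rightarrow> real) \<Rightarrow> nat \<Rightarrow> nat \<Rightarrow> complex" where
  "zn \<delta> u0 N n = zeta \<delta> (kap \<delta> u0 N n)"

definition cn :: "real \<Rightarrow> (real \<Rightarrow> real) \<Rightarrow> nat \<Rightarrow> nat \<Rightarrow> real" where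
  "cn \<delta> u0 N n = exp (2 * thetap \<delta> u0 (kap \<delta> u0 N n) / epsN \<delta> u0 N)"

definition Dent :: "real \<Rightarrow> (real \<Rightarrow> real) \<Rightarrow> nat \<Rightarrow> nat \<Rightarrow> complex \<Rightarrow> real \<Rightarrow> complex" where
  "Dent \<delta> u0 N n z t = complex_of_real (sqrt (cn \<delta> u0 N n)) *
     exp (- complex_of_real (kap \<delta> u0 N n) * z / complex_of_real (epsN \<delta> u0 N)
          - complex_of_real (Im ((zn \<delta> u0 N n - complex_of_real (1 / (2 * \<delta>)))\<^sup>2) * t / epsN \<delta> u0 N))"

definition Cent :: "real \<Rightarrow> (real \<Rightarrow> real) \<Rightarrow> nat \<Rightarrow> nat \<Rightarrow> nat \<Rightarrow> complex" where
  "Cent \<delta> u0 N n l = \<i> / (zn \<delta> u0 N l - cnj (zn \<delta> u0 N n))"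

text \<open>Z_N(z,t) = det(I_N + D_N C_N D_N); matrix row/column i (0-based) corresponds to index i+1.\<close>
definition ZN :: "real \<Rightarrow> (real \<Rightarrow> real) \<Rightarrow> nat \<Rightarrow> complex \<Rightarrow> real \<Rightarrow> complex" where
  "ZN \<delta> u0 N z t = det (mat N N (\<lambda>(i, j).
      (if i = j then 1 else 0)
      + Dent \<delta> u0 N (Suc i) z t * Cent \<delta> u0 N (Suc i) (Suc j) * Dent \<delta> u0 N (Suc j) z t))"

definition VV :: "real \<Rightarrow> (real \<Rightarrow> real) \<Rightarrow> real \<Rightarrow> real \<Rightarrow> real \<Rightarrow> real" where
  "VV \<delta> u0 \<kappa> z t = z * \<kappa> + t * Im ((zeta \<delta> \<kappa> - complex_of_real (1 / (2 * \<delta>)))\<^sup>2) - thetap \<delta> u0 \<kappa>"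

definition gg :: "complex \<Rightarrow> complex \<Rightarrow> real" where
  "gg \<zeta> \<mu> = (if \<zeta> = \<mu> then ln (cmod (\<zeta> - cnj \<zeta>))
             else ln (cmod ((\<zeta> - cnj \<mu>) / (\<zeta> - \<mu>))))"

definition ENS :: "real \<Rightarrow> (real \<Rightarrow> real) \<Rightarrow> nat \<Rightarrow> nat set \<Rightarrow> real \<Rightarrow> real \<Rightarrow> real" where
  "ENS \<delta> u0 N S z t =
     pi * epsN \<delta> u0 N * (\<Sum>n\<in>S. VV \<delta> u0 (kap \<delta> u0 N n) z t)
     + pi * (epsN \<delta> u0 N)\<^sup>2 / 2 * (\<Sum>n\<in>S. \<Sum>l\<in>S. gg (zn \<delta> u0 N n) (zn \<delta> u0 N l))"

definition Emin :: "real \<Rightarrow> (real \<Rightarrow> real) \<Rightarrow> nat \<Rightarrow> real \<Rightarrow> real \<Rightarrow> real" where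
  "Emin \<delta> u0 N x t = Min ((\<lambda>S. ENS \<delta> u0 N S x t) ` Pow {1..N})"

definition dfun :: "real \<Rightarrow> real" where
  "dfun \<theta> = (if \<theta> \<le> pi / 2 then 1 else sin \<theta>)"

definition strip :: "real \<Rightarrow> (real \<Rightarrow> real) \<Rightarrow> nat \<Rightarrow> complex set" where
  "strip \<delta> u0 N = {w. \<bar>Im w\<bar> \<le> \<delta> * epsN \<delta> u0 N}"

definition arg_branch :: "real \<Rightarrow> (real \<Rightarrow> real) \<Rightarrow> nat \<Rightarrow> real \<Rightarrow> (complex \<Rightarrow> real) \<Rightarrow> bool" where
  "arg_branch \<delta> u0 N t \<phi> \<longleftrightarrow>
     continuous_on (strip \<delta> u0 N) \<phi> \<and>
     (\<forall>w\<in>strip \<delta> u0 N. ZN \<delta> u0 N w t = complex_of_real (cmod (ZN \<delta> u0 N w t)) * exp (\<i> * complex_of_real (\<phi> w))) \<and>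
     (\<forall>r::real. \<phi> (complex_of_real r) = 0)"

end

theory Submission
  imports Defs "Jordan_Normal_Form.Char_Poly" "HOL-Real_Asymp.Real_Asymp"
begin

text \<open>On the strip the matrix is \<open>U A U\<close>, where \<open>A\<close> is its positive semidefinite value at
  \<open>Re z\<close> and \<open>U\<close> is the diagonal unitary matrix with entries
  \<open>exp (- \<i> \<kappa>\<^sub>n Im z / \<epsilon>\<^sub>N)\<close>. If \<open>U A U v = m v\<close> then, with \<open>w = U v\<close>,
  \<open>\<langle>w, A w\<rangle> = m \<Sum>\<^sub>n \<bar>w\<^sub>n\<bar>\<^sup>2 U\<^sub>n\<^sup>-\<^sup>2\<close>, and the sum lies in a convex
  sector of opening \<open>\<theta> = 2 \<kappa>\<^sub>m\<^sub>a\<^sub>x \<bar>Im z\<bar> / \<epsilon>\<^sub>N < pi\<close>. So every eigenvalue \<open>m\<close> lies in a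
  sector of opening \<open>\<theta>\<close> along the positive axis, and each factor \<open>1 + m\<close> of the determinant
  has modulus at least \<open>d \<theta>\<close> and argument between \<open>0\<close> and \<open>\<plusminus> \<theta>\<close>. The upper bound is the
  triangle inequality in the expansion of the determinant over subsets. The numbers
  \<open>\<kappa>\<^sub>n\<close> exist because \<open>R(\<kappa>)\<close> is the integral over the whole line of a continuous strictly
  increasing function of \<open>2 \<delta> (u\<^sub>0 - E(\<kappa>))\<close>, extended by \<open>0\<close> to negative arguments.\<close>

section \<open>Real Lambert branches\<close>

text \<open>The width of the strip is what makes the sector argument work: \<bar>Im z\<bar> \<le>
  \<delta> \<epsilon> gives \<theta> \<le> 2 \<delta> \<open>kmax\<close>, and \<open>kmax\<close> <
  pi / (2 \<delta>) keeps this below pi. The half-angle h = \<theta> / 2 then has cos h > 0, which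
  is what convexity of the sector requires. From \<open>u0\<close> the determinant part takes that
  bound on \<open>kmax\<close>, positivity of \<open>epsN\<close>, and that the numbers
  \<open>kap\<close> are distinct, positive and below \<open>kmax\<close>. All of these go back to
  definite descriptions, so each fact rests on an existence and uniqueness proof reaching down to
  the Lambert branches. The two real branches meet with a square-root singularity, where derivative
  bounds fail. Hoelder estimates of exponent 1/2 replace them, and they also explain why
  integrability of sqrt u0 is the natural condition at \<kappa> = 0.\<close>

lemma sqrt_minus_one_power2_le:
  assumes "0 < (p::real)"
  shows "(sqrt p - 1)\<^sup>2 \<le> p - 1 - ln p"
proof -
  have "ln p = 2 * ln (sqrt p)" using assms by (simp add: ln_sqrt)
  also have "\<dots> \<le> 2 * (sqrt p - 1)" using assms ln_le_minus_one[of "sqrt p"] by simp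
  finally show ?thesis using assms by (simp add: power2_diff)
qed

text \<open>Away from its minimum at 1, the function p - 1 - ln p grows at least as fast as it does
  from 1; the inequality p' \<le> p (1 + (p' - p)) expresses this. Growth from the minimum is
  quadratic, so the inverse is Hoelder of exponent 1/2.\<close>

lemma minus_ln_increment_ge_right:
  assumes "1 \<le> (p::real)" "p \<le> p'"
  shows "(sqrt (1 + (p' - p)) - 1)\<^sup>2 \<le> (p' - 1 - ln p') - (p - 1 - ln p)"
proof -
  have "1 * (p' - p) \<le> p * (p' - p)" using assms by (intro mult_right_mono) auto
  then have "p' \<le> p * (1 + (p' - p))" by (simp add: algebra_simps)
  then have "ln p' \<le> ln (p * (1 + (p' - p)))" using assms by simp
  also have "\<dots> = ln p + ln (1 + (p' - p))" using assms by (intro ln_mult_pos) auto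
  finally have "ln p' \<le> ln p + ln (1 + (p' - p))" .
  with sqrt_minus_one_power2_le[of "1 + (p' - p)"] assms show ?thesis by simp
qed

lemma minus_ln_increment_ge_left:
  assumes "0 < (p'::real)" "p' \<le> p" "p \<le> 1"
  shows "(sqrt (1 - (p - p')) - 1)\<^sup>2 \<le> (p' - 1 - ln p') - (p - 1 - ln p)"
proof -
  have "p * (p - p') \<le> 1 * (p - p')" using assms by (intro mult_right_mono) auto
  then have "p' \<le> p * (1 - (p - p'))" by (simp add: algebra_simps)
  then have "ln p' \<le> ln (p * (1 - (p - p')))" using assms by simp
  also have "\<dots> = ln p + ln (1 - (p - p'))" using assms by (intro ln_mult_pos) auto
  finally have "ln p' \<le> ln p + ln (1 - (p - p'))" .
  with sqrt_minus_one_power2_le[of "1 - (p - p')"] assms show ?thesis by simp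
qed

lemma minus_ln_inj_ge_1:
  assumes "1 \<le> (p::real)" "1 \<le> p'" "p - 1 - ln p = p' - 1 - ln p'"
  shows "p = p'"
proof -
  have "p = p'" if "1 \<le> p" "p \<le> p'" "p - 1 - ln p = p' - 1 - ln p'" for p p' :: real
    using minus_ln_increment_ge_right[OF that(1,2)] that by simp
  from this[of p' p] this[of p p'] show ?thesis using assms by (metis linear)
qed

lemma minus_ln_inj_le_1:
  assumes "0 < (p::real)" "p \<le> 1" "0 < p'" "p' \<le> 1" "p - 1 - ln p = p' - 1 - ln p'"
  shows "p = p'"
proof -
  have "p = p'" if "0 < p'" "p' \<le> p" "p \<le> 1" "p - 1 - ln p = p' - 1 - ln p'" for p p' :: real
    using minus_ln_increment_ge_left[OF that(1,2,3)] that by simp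
  from this[of p' p] this[of p p'] show ?thesis using assms by (metis linear)
qed

lemma mult_exp_eq_iff:
  "(w::real) * exp w = - exp (- 1 - s) \<longleftrightarrow> w < 0 \<and> - w - 1 - ln (- w) = s"
proof -
  have "w < 0" if "w * exp w = - exp (- 1 - s)"
  proof (rule ccontr)
    assume "\<not> w < 0"
    then have "0 \<le> w * exp w" by simp
    with that show False using exp_gt_zero[of "- 1 - s"] by linarith
  qed
  moreover have "w * exp w = - exp (- 1 - s) \<longleftrightarrow> - w - 1 - ln (- w) = s" if "w < 0"
  proof -
    have "w * exp w = - exp (- 1 - s) \<longleftrightarrow> exp (ln (- w)) * exp w = exp (- 1 - s)"
      using that by auto
    also have "\<dots> \<longleftrightarrow> ln (- w) + w = - 1 - s" by (simp add: exp_add[symmetric])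
    finally show ?thesis by auto
  qed
  ultimately show ?thesis by blast
qed

text \<open>With \<open>w = - p\<close>, the equation \<open>w * exp w = - exp (- 1 - s)\<close> reads \<open>p - 1 - ln p = s\<close>; its
  solutions \<open>lamb_lo s \<le> 1 \<le> lamb_hi s\<close> are the negatives of the two real Lambert branches.\<close>

definition lamb_lo :: "real \<Rightarrow> real" where "lamb_lo s = - Re (W0 (- exp (- 1 - s)))"
definition lamb_hi :: "real \<Rightarrow> real" where "lamb_hi s = - Re (Wm1 (- exp (- 1 - s)))"

lemma lamb_lo:
  assumes "0 \<le> s"
  shows "0 < lamb_lo s" "lamb_lo s \<le> 1" "lamb_lo s - 1 - ln (lamb_lo s) = s"
    "W0 (- exp (- 1 - s)) = - of_real (lamb_lo s)"
proof -
  \<comment> \<open>At the left endpoint the expression equals exp (- 1 - s) + s, which already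
    exceeds s; the endpoint also keeps p positive.\<close>
  have "\<exists>p. exp (- 1 - s) \<le> p \<and> p \<le> 1 \<and> p - 1 - ln p = s"
    by (rule IVT2') (use assms in \<open>auto intro!: continuous_intros\<close>)
  then obtain p where p: "exp (- 1 - s) \<le> p" "p \<le> 1" "p - 1 - ln p = s" by blast
  then have p0: "0 < p" using exp_gt_zero[of "- 1 - s"] by linarith
  have "(THE w. - 1 \<le> w \<and> w * exp w = - exp (- 1 - s)) = - p"
    unfolding mult_exp_eq_iff
  proof (rule the_equality)
    fix w :: real assume "- 1 \<le> w \<and> w < 0 \<and> - w - 1 - ln (- w) = s"
    then show "w = - p" using minus_ln_inj_le_1[of "- w" p] p p0 by simp
  qed (use p p0 in auto)
  moreover have "- exp (- 1) \<le> - exp (- 1 - s)" using assms by simp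
  ultimately have W: "W0 (- exp (- 1 - s)) = - of_real p" by (simp add: W0_def)
  then have "lamb_lo s = p" by (simp add: lamb_lo_def)
  with W p p0 show "0 < lamb_lo s" "lamb_lo s \<le> 1" "lamb_lo s - 1 - ln (lamb_lo s) = s"
    "W0 (- exp (- 1 - s)) = - of_real (lamb_lo s)" by auto
qed

lemma lamb_hi:
  assumes "0 \<le> s"
  shows "1 \<le> lamb_hi s" "lamb_hi s - 1 - ln (lamb_hi s) = s"
    "Wm1 (- exp (- 1 - s)) = - of_real (lamb_hi s)"
proof -
  \<comment> \<open>The right endpoint (1 + sqrt s)^2 is the point where the lower bound (sqrt p -
    1)^2 equals s.\<close>
  have "(sqrt ((1 + sqrt s)\<^sup>2) - 1)\<^sup>2 \<le> (1 + sqrt s)\<^sup>2 - 1 - ln ((1 + sqrt s)\<^sup>2)"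
    using assms by (intro sqrt_minus_one_power2_le zero_less_power) (simp add: add_pos_nonneg)
  then have le: "s \<le> (1 + sqrt s)\<^sup>2 - 1 - ln ((1 + sqrt s)\<^sup>2)" using assms by simp
  have "\<exists>p. 1 \<le> p \<and> p \<le> (1 + sqrt s)\<^sup>2 \<and> p - 1 - ln p = s"
    by (rule IVT') (use assms le in \<open>auto intro!: continuous_intros one_le_power\<close>)
  then obtain p where p: "1 \<le> p" "p - 1 - ln p = s" by blast
  have "(THE w. w \<le> - 1 \<and> w * exp w = - exp (- 1 - s)) = - p"
    unfolding mult_exp_eq_iff
  proof (rule the_equality)
    fix w :: real assume "w \<le> - 1 \<and> w < 0 \<and> - w - 1 - ln (- w) = s"
    then show "w = - p" using minus_ln_inj_ge_1[of "- w" p] p by simp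
  qed (use p in auto)
  moreover have "- exp (- 1) \<le> - exp (- 1 - s)" using assms by simp
  ultimately have W: "Wm1 (- exp (- 1 - s)) = - of_real p" by (simp add: Wm1_def)
  then have "lamb_hi s = p" by (simp add: lamb_hi_def)
  with W p show "1 \<le> lamb_hi s" "lamb_hi s - 1 - ln (lamb_hi s) = s"
    "Wm1 (- exp (- 1 - s)) = - of_real (lamb_hi s)" by auto
qed

text \<open>With r^2 = 1 - (drop), the increment estimate gives 1 - r \<le> sqrt (s' - s), and the
  drop is (1 - r)(1 + r) \<le> 2 (1 - r). The square root cannot be improved to a Lipschitz bound,
  since the slope at s = 0 is infinite.\<close>

lemma lamb_lo_diff:
  assumes "0 \<le> s" "s \<le> s'"
  shows "lamb_lo s' \<le> lamb_lo s" "lamb_lo s - lamb_lo s' \<le> 2 * sqrt (s' - s)"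
proof -
  have s': "0 \<le> s'" using assms by simp
  note lo = lamb_lo[OF assms(1)] and lo' = lamb_lo[OF s']
  show le: "lamb_lo s' \<le> lamb_lo s"
  proof (rule ccontr)
    assume n: "\<not> lamb_lo s' \<le> lamb_lo s"
    then have "(sqrt (1 - (lamb_lo s' - lamb_lo s)) - 1)\<^sup>2 \<le> s - s'"
      using minus_ln_increment_ge_left[of "lamb_lo s" "lamb_lo s'"] lo lo' by simp
    with n assms(2) show False by (smt (verit) real_sqrt_eq_1_iff zero_less_power2)
  qed
  define r where "r = sqrt (1 - (lamb_lo s - lamb_lo s'))"
  have "(r - 1)\<^sup>2 \<le> s' - s"
    using minus_ln_increment_ge_left[of "lamb_lo s'" "lamb_lo s"] lo lo' le by (simp add: r_def)
  then have "\<bar>r - 1\<bar> \<le> sqrt (s' - s)" by (metis real_sqrt_abs real_sqrt_le_mono)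
  moreover have r': "0 \<le> r" "r \<le> 1" "r * r = 1 - (lamb_lo s - lamb_lo s')" using le lo lo' by (auto simp: r_def)
  moreover have "(1 - r) * (1 + r) \<le> (1 - r) * 2" using r' by (intro mult_left_mono) auto
  then have "1 - r * r \<le> (1 - r) * 2" by (simp only: ring_distribs)
  ultimately have "lamb_lo s - lamb_lo s' \<le> 2 * (1 - r)" "1 - r \<le> sqrt (s' - s)" by auto
  then show "lamb_lo s - lamb_lo s' \<le> 2 * sqrt (s' - s)"
    by (meson mult_left_mono order_trans zero_le_numeral)
qed

lemma lamb_hi_diff:
  assumes "0 \<le> s" "s \<le> s'"
  shows "lamb_hi s \<le> lamb_hi s'" "lamb_hi s' - lamb_hi s \<le> 2 * sqrt (s' - s) + (s' - s)"
    "s < s' \<Longrightarrow> lamb_hi s < lamb_hi s'"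
proof -
  have s': "0 \<le> s'" using assms by simp
  note hi = lamb_hi[OF assms(1)] and hi' = lamb_hi[OF s']
  show le: "lamb_hi s \<le> lamb_hi s'"
  proof (rule ccontr)
    assume n: "\<not> lamb_hi s \<le> lamb_hi s'"
    then have "(sqrt (1 + (lamb_hi s - lamb_hi s')) - 1)\<^sup>2 \<le> s - s'"
      using minus_ln_increment_ge_right[of "lamb_hi s'" "lamb_hi s"] hi hi' by simp
    with n assms(2) show False by (smt (verit) real_sqrt_eq_1_iff zero_less_power2)
  qed
  show "lamb_hi s < lamb_hi s'" if "s < s'" using le hi(2) hi'(2) that by (cases "lamb_hi s = lamb_hi s'") auto
  let ?r = "sqrt (1 + (lamb_hi s' - lamb_hi s))"
  have "(?r - 1)\<^sup>2 \<le> s' - s"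
    using minus_ln_increment_ge_right[of "lamb_hi s" "lamb_hi s'"] hi hi' le by simp
  then have "\<bar>?r - 1\<bar> \<le> sqrt (s' - s)" by (metis real_sqrt_abs real_sqrt_le_mono)
  then have "?r \<le> 1 + sqrt (s' - s)" by linarith
  then have "?r\<^sup>2 \<le> (1 + sqrt (s' - s))\<^sup>2" using le by (intro power_mono) auto
  then show "lamb_hi s' - lamb_hi s \<le> 2 * sqrt (s' - s) + (s' - s)"
    using le assms by (simp add: power2_sum)
qed

section \<open>The gap between the two real branches\<close>

definition lamb_gap :: "real \<Rightarrow> real" where
  "lamb_gap s = lamb_hi (max 0 s) - lamb_lo (max 0 s)"

lemma lamb_gap_eq:
  "0 \<le> s \<Longrightarrow> W0 (- exp (- 1 - s)) - Wm1 (- exp (- 1 - s)) = of_real (lamb_gap s)"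
  by (simp add: lamb_gap_def lamb_lo(4) lamb_hi(3))

text \<open>The clamped argument is 0, and there p = 1 is the only solution on either side of 1, so
  the branches coincide.\<close>

lemma lamb_gap_nonpos: "s \<le> 0 \<Longrightarrow> lamb_gap s = 0"
  using lamb_lo[of 0] lamb_hi[of 0] minus_ln_inj_le_1[of "lamb_lo 0" 1] minus_ln_inj_ge_1[of "lamb_hi 0" 1]
  by (simp add: lamb_gap_def max_def)

lemma lamb_gap_mono: "s \<le> s' \<Longrightarrow> lamb_gap s \<le> lamb_gap s'"
  unfolding lamb_gap_def by (intro diff_mono lamb_hi_diff(1) lamb_lo_diff(1)) auto

lemma lamb_gap_nonneg: "0 \<le> lamb_gap s"
  using lamb_gap_mono[of "min 0 s" s] lamb_gap_nonpos[of "min 0 s"] by simp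

lemma lamb_gap_strict: "s < s' \<Longrightarrow> 0 < s' \<Longrightarrow> lamb_gap s < lamb_gap s'"
  unfolding lamb_gap_def by (intro diff_strict_right_mono less_le_trans[OF diff_strict_right_mono diff_left_mono] lamb_hi_diff(3) lamb_lo_diff(1)) auto

text \<open>Used twice: as a modulus of continuity, and with s' = 0 as a growth bound that yields an
  integrable majorant.\<close>

lemma lamb_gap_diff: "\<bar>lamb_gap s - lamb_gap s'\<bar> \<le> 4 * sqrt \<bar>s - s'\<bar> + \<bar>s - s'\<bar>"
proof -
  have *: "lamb_gap s' - lamb_gap s \<le> 4 * sqrt (s' - s) + (s' - s)" if "s \<le> s'" for s s'
  proof -
    let ?d = "max 0 s' - max 0 s"
    have "lamb_gap s' - lamb_gap s \<le> 4 * sqrt ?d + ?d"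
      using lamb_hi_diff(2)[of "max 0 s" "max 0 s'"] lamb_lo_diff(2)[of "max 0 s" "max 0 s'"] that
      by (simp add: lamb_gap_def max.coboundedI2)
    moreover have "?d \<le> s' - s" using that by auto
    moreover from this have "sqrt ?d \<le> sqrt (s' - s)" by (rule real_sqrt_le_mono)
    ultimately show ?thesis by linarith
  qed
  show ?thesis
    using *[of s s'] *[of s' s] lamb_gap_mono[of s s'] lamb_gap_mono[of s' s] by (cases "s \<le> s'") auto
qed

lemma continuous_lamb_gap: "continuous_on UNIV lamb_gap"
proof (intro continuous_at_imp_continuous_on ballI)
  fix s :: real
  have "((\<lambda>x. 4 * sqrt \<bar>x - s\<bar> + \<bar>x - s\<bar>) \<longlongrightarrow> 4 * sqrt \<bar>s - s\<bar> + \<bar>s - s\<bar>) (at s)"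
    by (intro tendsto_intros)
  then have lim: "((\<lambda>x. 4 * sqrt \<bar>x - s\<bar> + \<bar>x - s\<bar>) \<longlongrightarrow> 0) (at s)" by simp
  have "((\<lambda>x. lamb_gap x - lamb_gap s) \<longlongrightarrow> 0) (at s)"
    by (rule Lim_null_comparison[OF _ lim]) (use lamb_gap_diff[of _ s] in simp)
  then show "isCont lamb_gap s" unfolding isCont_def by (simp add: LIM_zero_iff)
qed

section \<open>The parametrization of the spectrum\<close>

text \<open>This is 2 \<delta> E along the spectral curve, in the variable x = 2 \<delta> \<kappa>.
  The value at 0 fills a removable singularity.\<close>

definition efun :: "real \<Rightarrow> real" where
  "efun x = (if x = 0 then 0 else 1 - x * cot x + ln (x / sin x))"

lemma continuous_efun: "continuous_on {0..<pi} efun"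
proof -
  have "continuous (at x within {0..<pi}) efun" if "x \<in> {0..<pi}" for x
  proof (cases "x = 0")
    case True
    have "((\<lambda>x. 1 - x * (cos x / sin x) + ln (x / sin x)) \<longlongrightarrow> (0::real)) (at_right 0)"
      by real_asymp
    then have "(efun \<longlongrightarrow> 0) (at_right 0)"
      by (rule Lim_transform_eventually) (auto simp: efun_def cot_def eventually_at_right_field intro: exI[of _ 1])
    then have "(efun \<longlongrightarrow> efun 0) (at_right 0)" by (simp add: efun_def)
    moreover have "at 0 within {0..<pi} \<le> at_right 0"
      unfolding at_within_def by (intro inf_mono order_refl) auto
    ultimately have "(efun \<longlongrightarrow> efun 0) (at 0 within {0..<pi})" by (rule tendsto_mono[rotated])
    then show ?thesis using True by (simp add: continuous_within)
  next
    case False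
    then have s: "0 < sin x" "x > 0" using that by (auto intro!: sin_gt_zero)
    have "isCont (\<lambda>x. 1 - x * cot x + ln (x / sin x)) x"
      using s by (intro continuous_intros) auto
    then have "(\<lambda>x. 1 - x * cot x + ln (x / sin x)) \<midarrow>x\<rightarrow> efun x"
      using s by (simp add: isCont_def efun_def)
    then have "(efun \<longlongrightarrow> efun x) (at x)"
      by (rule Lim_transform_eventually)
         (use s in \<open>auto simp: efun_def eventually_at dist_real_def intro!: exI[of _ x]\<close>)
    then show ?thesis by (meson continuous_at_imp_continuous_at_within isCont_def)
  qed
  then show ?thesis by (simp add: continuous_on_eq_continuous_within)
qed

lemma efun_strict_mono:
  assumes "0 \<le> x" "x < y" "y < pi"
  shows "efun x < efun y"
proof (rule DERIV_pos_imp_increasing_open[OF assms(2)])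
  fix z assume z: "x < z" "z < y"
  then have s: "0 < sin z" "0 < z" using assms by (auto intro!: sin_gt_zero)
  have D: "((\<lambda>x. 1 - x * (cos x / sin x) + ln (x / sin x)) has_real_derivative
     - (cos z / sin z + z * (- (sin z * sin z) - cos z * cos z) / (sin z * sin z))
        + (sin z - z * cos z) / (sin z * sin z) / (z / sin z)) (at z)"
    using s by (auto intro!: derivative_eq_intros simp: field_simps)
  \<comment> \<open>The numerator sin^2 z - 2 z sin z cos z + z^2 is rewritten as a sum of two
    squares, which makes its sign visible.\<close>
  have val: "- (cos z / sin z + z * (- (sin z * sin z) - cos z * cos z) / (sin z * sin z))
        + (sin z - z * cos z) / (sin z * sin z) / (z / sin z)
     = ((sin z - z * cos z)\<^sup>2 + (z * sin z)\<^sup>2) / (z * (sin z)\<^sup>2)"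
    using s by (simp add: field_simps power2_eq_square)
  have pos: "0 < - (cos z / sin z + z * (- (sin z * sin z) - cos z * cos z) / (sin z * sin z))
        + (sin z - z * cos z) / (sin z * sin z) / (z / sin z)"
    unfolding val using s by (intro divide_pos_pos add_nonneg_pos) auto
  have conv: "(efun has_real_derivative D) (at z) \<longleftrightarrow> ((\<lambda>x. 1 - x * (cos x / sin x) + ln (x / sin x)) has_real_derivative D) (at z)" for D
  proof (rule DERIV_cong_ev[OF refl _ refl])
    show "\<forall>\<^sub>F x in nhds z. efun x = 1 - x * (cos x / sin x) + ln (x / sin x)"
      using eventually_nhds_in_open[of "{0<..}" z] s
      by (auto simp: efun_def cot_def elim!: eventually_mono)
  qed
  show "\<exists>D. (efun has_real_derivative D) (at z) \<and> 0 < D"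
    using pos D[folded conv] by blast
qed (use assms in \<open>auto intro!: continuous_on_subset[OF continuous_efun]\<close>)

lemma efun_surj:
  assumes "0 \<le> m"
  obtains x where "0 \<le> x" "x < pi" "efun x = m"
proof -
  \<comment> \<open>The point in [pi/2, pi) with sin y = exp (- m): there ln (y / sin y) = ln y + m
    \<ge> m, while - y cot y \<ge> 0, so \<open>efun y\<close> is at least m.\<close>
  define y where "y = pi - arcsin (exp (- m))"
  have e: "0 < exp (- m)" "exp (- m) \<le> 1" "- 1 \<le> exp (- m)" using assms by (auto intro: order_trans[of _ 0])
  have a: "0 < arcsin (exp (- m))" "arcsin (exp (- m)) \<le> pi / 2"
    using e arcsin_less_arcsin[of 0 "exp (- m)"] arcsin_ubound[of "exp (- m)"] by (auto simp: order_trans[of "-1" 0])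
  then have y: "pi / 2 \<le> y" "y < pi" by (auto simp: y_def)
  have sy: "sin y = exp (- m)" using e sin_arcsin[of "exp (- m)"] by (simp add: y_def)
  have cy: "cos y \<le> 0" using y cos_monotone_0_pi_le[of "pi / 2" y] by auto
  have "1 \<le> y" using y pi_ge_two by linarith
  have "m \<le> ln (y / sin y)"
  proof -
    have "ln (y / sin y) = ln y + m" using sy \<open>1 \<le> y\<close> by (simp add: ln_div)
    then show ?thesis using \<open>1 \<le> y\<close> by simp
  qed
  moreover have "y * cot y \<le> 0" using cy sy \<open>1 \<le> y\<close> e
    by (auto simp: cot_def intro!: mult_nonneg_nonpos divide_nonpos_pos)
  ultimately have "m \<le> efun y" using \<open>1 \<le> y\<close> by (simp add: efun_def)
  moreover have "efun 0 \<le> m" using assms by (simp add: efun_def)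
  ultimately have "\<exists>x\<ge>0. x \<le> y \<and> efun x = m"
    using y \<open>1 \<le> y\<close> by (intro IVT' continuous_on_subset[OF continuous_efun]) auto
  then show thesis using that y by force
qed

text \<open>With x = 2 \<delta> \<kappa>, x cot x + i x is (x / sin x) exp (i x). The modulus
  supplies the logarithm in E, and the phase is the one that cancels in a.\<close>

lemma zeta_polar:
  assumes "0 < \<delta>" "0 < k" "2 * \<delta> * k < pi"
  shows "complex_of_real (2 * \<delta>) * zeta \<delta> k = of_real (2 * \<delta> * k / sin (2 * \<delta> * k)) * cis (2 * \<delta> * k)"
proof -
  have "0 < sin (2 * \<delta> * k)" using assms by (intro sin_gt_zero) auto
  then show ?thesis using assms by (simp add: zeta_def complex_eq_iff cot_def)
qed

lemma Ek_efun:
  assumes "0 < \<delta>" "0 \<le> k" "2 * \<delta> * k < pi"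
  shows "Ek \<delta> k = efun (2 * \<delta> * k) / (2 * \<delta>)"
proof (cases "k = 0")
  case True
  then show ?thesis using assms by (simp add: Ek_def EE_def zeta_def efun_def)
next
  case False
  let ?x = "2 * \<delta> * k"
  have s: "0 < sin ?x" "0 < k" using False assms by (auto intro!: sin_gt_zero)
  have x: "0 < ?x / sin ?x" using s assms by simp
  then have nz: "complex_of_real (2 * \<delta>) * zeta \<delta> k \<noteq> 0"
    unfolding zeta_polar[OF assms(1) s(2) assms(3)] by auto
  have "Re (Ln (complex_of_real (2 * \<delta>) * zeta \<delta> k)) = ln (cmod (complex_of_real (2 * \<delta>) * zeta \<delta> k))"
    using nz by (rule Re_Ln)
  also have "cmod (complex_of_real (2 * \<delta>) * zeta \<delta> k) = ?x / sin ?x"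
    unfolding zeta_polar[OF assms(1) s(2) assms(3)] by (simp only: norm_mult norm_of_real norm_cis abs_of_pos[OF x] mult_1_right)
  finally have L: "Re (Ln (complex_of_real (2 * \<delta>) * zeta \<delta> k)) = ln (?x / sin ?x)" .
  have "Ek \<delta> k = - (k * cot ?x) + 1 / (2 * \<delta>) * (1 + Re (Ln (complex_of_real (2 * \<delta>) * zeta \<delta> k)))"
    using s(2) by (simp add: Ek_def EE_def zeta_def)
  then show ?thesis unfolding L using s assms by (simp add: efun_def field_simps)
qed

text \<open>The phase of \<zeta> cancels that of the exponential. In the parameter s of the real
  branches this reads s = 2 \<delta> (u - E), so the real branches are met exactly where u \<ge>
  E.\<close>

lemma aa_eq:
  assumes "0 < \<delta>" "0 \<le> k" "2 * \<delta> * k < pi"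
  shows "aa \<delta> k u = - exp (- 1 - 2 * \<delta> * (u - Ek \<delta> k))"
proof (cases "k = 0")
  case True
  have "exp (- complex_of_real (2 * \<delta>) * (zeta \<delta> 0 + of_real u)) = of_real (exp (- 1 - 2 * \<delta> * u))"
    using assms by (simp add: zeta_def exp_of_real[symmetric] algebra_simps)
  then show ?thesis using assms True by (simp add: aa_def Ek_efun efun_def zeta_def)
next
  case False
  let ?x = "2 * \<delta> * k"
  have s: "0 < sin ?x" "0 < k" using False assms by (auto intro!: sin_gt_zero)
  have x: "0 < ?x / sin ?x" using s assms by simp
  have "- complex_of_real (2 * \<delta>) * (zeta \<delta> k + of_real u) = of_real (- (?x * cot ?x) - 2 * \<delta> * u) + \<i> * of_real (- ?x)"
    using s by (simp add: zeta_def complex_eq_iff algebra_simps)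
  then have "exp (- complex_of_real (2 * \<delta>) * (zeta \<delta> k + of_real u)) = of_real (exp (- (?x * cot ?x) - 2 * \<delta> * u)) * cis (- ?x)"
    by (simp only: exp_add cis_conv_exp exp_of_real)
  then have "- complex_of_real (2 * \<delta>) * zeta \<delta> k * exp (- complex_of_real (2 * \<delta>) * (zeta \<delta> k + of_real u))
    = - (of_real (?x / sin ?x) * cis ?x * (of_real (exp (- (?x * cot ?x) - 2 * \<delta> * u)) * cis (- ?x)))"
    using zeta_polar[OF assms(1) s(2) assms(3)] by simp
  also have "\<dots> = - of_real (?x / sin ?x * exp (- (?x * cot ?x) - 2 * \<delta> * u)) * (cis ?x * cis (- ?x))"
  proof -
    have "- (a * c * (b * d)) = - (a * b) * (c * d)" for a b c d :: complex
      by (simp add: algebra_simps)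
    then show ?thesis unfolding of_real_mult .
  qed
  also have "\<dots> = of_real (- (?x / sin ?x * exp (- (?x * cot ?x) - 2 * \<delta> * u)))"
    by (simp add: cis_mult)
  finally have "aa \<delta> k u = - (exp (ln (?x / sin ?x)) * exp (- (?x * cot ?x) - 2 * \<delta> * u))"
    unfolding aa_def using x by (simp del: of_real_mult of_real_divide of_real_minus)
  also have "\<dots> = - exp (ln (?x / sin ?x) + (- (?x * cot ?x) - 2 * \<delta> * u))"
    by (simp only: exp_add)
  also have "2 * \<delta> * Ek \<delta> k = 1 - ?x * cot ?x + ln (?x / sin ?x)"
    using s assms by (simp add: Ek_efun efun_def)
  then have "ln (?x / sin ?x) + (- (?x * cot ?x) - 2 * \<delta> * u) = - 1 - 2 * \<delta> * (u - Ek \<delta> k)"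
    by (simp only: right_diff_distrib)
  finally show ?thesis .
qed

text \<open>With y = Im w, reality of w exp w forces Re w = - y cot y, and its value is then - exp
  (efun y - 1). Strict monotonicity of \<open>efun\<close> makes y unique, as the definite
  description demands.\<close>

lemma W0_efun:
  assumes "0 < x" "x < pi"
  shows "W0 (- exp (efun x - 1)) = of_real (- (x * cot x)) + \<i> * of_real x"
proof -
  have char: "w * exp w = complex_of_real (- exp (efun x - 1)) \<longleftrightarrow> Re w = - (Im w * cot (Im w)) \<and> efun (Im w) = efun x"
    if w: "0 < Im w" "Im w < pi" for w
  proof -
    let ?y = "Im w"
    have s: "0 < sin ?y" using w by (intro sin_gt_zero)
    have re: "Re (w * exp w) = exp (Re w) * (Re w * cos ?y - ?y * sin ?y)"
      and im: "Im (w * exp w) = exp (Re w) * (Re w * sin ?y + ?y * cos ?y)"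
      by (simp_all add: Re_exp Im_exp algebra_simps)
    have im0: "Im (w * exp w) = 0 \<longleftrightarrow> Re w = - (?y * cot ?y)"
      unfolding im mult_eq_0_iff add_eq_0_iff2 using s by (auto simp: cot_def field_simps)
    have "Re (w * exp w) = - exp (efun ?y - 1)" if r: "Re w = - (?y * cot ?y)"
    proof -
      have "Re w * cos ?y - ?y * sin ?y = - (?y / sin ?y) * ((cos ?y)\<^sup>2 + (sin ?y)\<^sup>2)"
        unfolding r using s by (simp add: cot_def field_simps power2_eq_square del: sin_cos_squared_add sin_cos_squared_add2 sin_cos_squared_add3)
      then have "Re (w * exp w) = - (exp (- (?y * cot ?y)) * exp (ln (?y / sin ?y)))"
        unfolding re r using s w by simp
      then show ?thesis using w by (simp add: efun_def exp_add[symmetric])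
    qed
    then show ?thesis using im0 by (auto simp: complex_eq_iff simp del: times_complex.simps)
  qed
  have "(THE w. w * exp w = complex_of_real (- exp (efun x - 1)) \<and> 0 < Im w \<and> Im w < pi) = of_real (- (x * cot x)) + \<i> * of_real x"
  proof (rule the_equality)
    show "(complex_of_real (- (x * cot x)) + \<i> * of_real x) * exp (of_real (- (x * cot x)) + \<i> * of_real x) = complex_of_real (- exp (efun x - 1))
      \<and> 0 < Im (of_real (- (x * cot x)) + \<i> * of_real x) \<and> Im (of_real (- (x * cot x)) + \<i> * of_real x) < pi"
      using assms by (subst char) auto
    fix w :: complex
    assume w: "w * exp w = complex_of_real (- exp (efun x - 1)) \<and> 0 < Im w \<and> Im w < pi"
    then have "Re w = - (Im w * cot (Im w))" "efun (Im w) = efun x" using char by auto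
    moreover from this have "Im w = x"
      using efun_strict_mono[of "Im w" x] efun_strict_mono[of x "Im w"] w assms
      by (metis less_eq_real_def linorder_neqE_linordered_idom order_less_irrefl)
    ultimately show "w = of_real (- (x * cot x)) + \<i> * of_real x" by (simp add: complex_eq_iff)
  qed
  moreover have "\<not> - exp (- 1) \<le> - exp (efun x - 1)"
    using efun_strict_mono[of 0 x] assms by (simp add: efun_def)
  ultimately show ?thesis by (simp add: W0_def)
qed

text \<open>In this range \<open>Wm1\<close> is the conjugate of \<open>W0\<close>, so the minus
  sign in \<open>zeta_max\<close> restores a positive imaginary part. Thus \<open>kmax\<close> is
  the parameter at which E reaches the maximum of u0.\<close>

lemma kmax_efun:
  assumes "0 < \<delta>" "0 < umax u0"
  shows "0 < kmax \<delta> u0" "2 * \<delta> * kmax \<delta> u0 < pi" "Ek \<delta> (kmax \<delta> u0) = umax u0"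
proof -
  obtain x where x: "0 \<le> x" "x < pi" "efun x = 2 * \<delta> * umax u0"
    using efun_surj[of "2 * \<delta> * umax u0"] assms by auto
  have x0: "0 < x" using x assms by (cases "x = 0") (auto simp: efun_def)
  have "- exp (2 * \<delta> * umax u0 - 1) < - exp (- 1)" using assms by simp
  then have "zeta_max \<delta> u0 = - of_real (1 / (2 * \<delta>)) * cnj (W0 (- exp (efun x - 1)))"
    by (simp add: zeta_max_def Wm1_def x(3))
  then have k: "kmax \<delta> u0 = x / (2 * \<delta>)"
    unfolding W0_efun[OF x0 x(2)] kmax_def using assms by simp
  then have "2 * \<delta> * kmax \<delta> u0 = x" using assms by simp
  then show "0 < kmax \<delta> u0" "2 * \<delta> * kmax \<delta> u0 < pi" "Ek \<delta> (kmax \<delta> u0) = umax u0"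
    using x x0 assms k by (auto simp: Ek_efun)
qed

section \<open>The Weyl function and its levels\<close>

text \<open>\<open>xmax\<close> is a definite description; it is meaningful because every maximiser
  is a critical point and only one point can be critical.\<close>

lemma admissible_max:
  assumes "admissible u0"
  shows "u0 x \<le> umax u0" "deriv u0 x = 0 \<Longrightarrow> x = xmax u0" "0 < umax u0"
proof -
  obtain xm where xm: "\<And>x. u0 x \<le> u0 xm" "\<And>x. deriv u0 x = 0 \<Longrightarrow> x = xm"
    using assms by (auto simp: admissible_def)
  have "xmax u0 = xm"
    unfolding xmax_def
  proof (rule the_equality)
    fix x assume x: "\<forall>y. u0 y \<le> u0 x"
    have "u0 differentiable at x" using assms by (simp add: admissible_def)
    then have "DERIV u0 x :> deriv u0 x" by (simp add: DERIV_deriv_iff_real_differentiable)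
    then have "deriv u0 x = 0" by (rule DERIV_local_max[of _ _ _ 1]) (use x in auto)
    then show "x = xm" by (rule xm(2))
  qed (use xm in simp)
  then show "u0 x \<le> umax u0" "deriv u0 x = 0 \<Longrightarrow> x = xmax u0" "0 < umax u0"
    using xm assms by (auto simp: umax_def admissible_def)
qed

lemma admissible_continuous: "admissible u0 \<Longrightarrow> continuous_on A u0"
  by (auto simp: admissible_def intro!: continuous_at_imp_continuous_on differentiable_imp_continuous_within)

text \<open>Rolle gives a critical point in between, which can only be \<open>xmax\<close>. Hence u0
  is injective on either side of \<open>xmax\<close>, which makes the turning points unique.\<close>

lemma admissible_inj:
  assumes u: "admissible u0" and "u0 a = u0 b" "a < b"
  shows "a < xmax u0" "xmax u0 < b"
proof -
  have "\<exists>z>a. z < b \<and> DERIV u0 z :> 0"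
    by (rule Rolle[OF assms(3,2)]) (use u in \<open>auto simp: admissible_def intro: admissible_continuous[OF u]\<close>)
  then obtain z where z: "a < z" "z < b" "deriv u0 z = 0" by (auto dest: DERIV_imp_deriv)
  with admissible_max(2)[OF u] show "a < xmax u0" "xmax u0 < b" by auto
qed

lemma superlevel_set:
  assumes u: "admissible u0" and E: "0 < E" "E < umax u0" "Ek \<delta> k = E"
  shows "E \<le> u0 x \<longleftrightarrow> x \<in> {xminus \<delta> u0 k..xplus \<delta> u0 k}"
proof -
  note cont = admissible_continuous[OF u]
  have top: "eventually (\<lambda>x. u0 x < E) at_top" "eventually (\<lambda>x. u0 x < E) at_bot"
    using u E by (auto simp: admissible_def dest: order_tendstoD)
  \<comment> \<open>Decay at infinity forces a crossing to the right of every point of the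
    superlevel set. Since crossings right of \<open>xmax\<close> are unique, no such point lies
    beyond that crossing.\<close>
  have right: "\<exists>y\<ge>a. u0 y = E" if a: "E \<le> u0 a" for a
  proof -
    obtain b where b: "a \<le> b" "u0 b < E"
      using eventually_happens[OF eventually_conj[OF top(1) eventually_ge_at_top[of a]]] by auto
    have "\<exists>y\<ge>a. y \<le> b \<and> u0 y = E"
      by (rule IVT2') (use a b cont in auto)
    then show ?thesis by blast
  qed
  have left: "\<exists>y\<le>a. u0 y = E" if a: "E \<le> u0 a" for a
  proof -
    obtain b where b: "b \<le> a" "u0 b < E"
      using eventually_happens[OF eventually_conj[OF top(2) eventually_le_at_bot[of a]]] by auto
    have "\<exists>y\<ge>b. y \<le> a \<and> u0 y = E"
      by (rule IVT') (use a b cont in auto)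
    then show ?thesis by blast
  qed
  obtain p where p: "xmax u0 \<le> p" "u0 p = E" using right[of "xmax u0"] E by (auto simp: umax_def)
  obtain m where m: "m \<le> xmax u0" "u0 m = E" using left[of "xmax u0"] E by (auto simp: umax_def)
  have p_unique: "x = p" if "xmax u0 \<le> x" "u0 x = E" for x
    using admissible_inj(1)[OF u, of x p] admissible_inj(1)[OF u, of p x] p that
    by (metis linorder_not_less linorder_neqE_linordered_idom)
  have m_unique: "x = m" if "x \<le> xmax u0" "u0 x = E" for x
    using admissible_inj(2)[OF u, of x m] admissible_inj(2)[OF u, of m x] m that
    by (metis linorder_not_less linorder_neqE_linordered_idom)
  have "xplus \<delta> u0 k = p"
    unfolding xplus_def E(3) by (rule the_equality) (use p p_unique in blast)+
  moreover have "xminus \<delta> u0 k = m"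
    unfolding xminus_def E(3) by (rule the_equality) (use m m_unique in blast)+
  moreover have "E \<le> u0 x \<longleftrightarrow> x \<in> {m..p}"
  proof
    assume x: "E \<le> u0 x"
    obtain y where "y \<ge> x" "u0 y = E" using right[OF x] by blast
    then have "x \<le> p" using p_unique[of y] p by (cases "xmax u0 \<le> y") auto
    moreover obtain y where "y \<le> x" "u0 y = E" using left[OF x] by blast
    then have "m \<le> x" using m_unique[of y] m by (cases "y \<le> xmax u0") auto
    ultimately show "x \<in> {m..p}" by simp
  next
    assume x: "x \<in> {m..p}"
    show "E \<le> u0 x"
    proof (rule ccontr)
      assume n: "\<not> E \<le> u0 x"
      have E': "E < u0 (xmax u0)" using E by (simp add: umax_def)
      show False
      proof (cases "xmax u0 \<le> x")
        case True
        have "\<exists>y\<ge>xmax u0. y \<le> x \<and> u0 y = E" by (rule IVT2') (use n E' True cont in auto)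
        then show False using p_unique x n p by force
      next
        case False
        have "\<exists>y\<ge>x. y \<le> xmax u0 \<and> u0 y = E" by (rule IVT') (use n E' False cont in auto)
        then show False using m_unique x n m by force
      qed
    qed
  qed
  ultimately show ?thesis by simp
qed

section \<open>The Weyl function as an integral over the whole line\<close>

definition lamb_int :: "real \<Rightarrow> (real \<Rightarrow> real) \<Rightarrow> real \<Rightarrow> real" where
  "lamb_int \<delta> u0 E = integral UNIV (\<lambda>x. lamb_gap (2 * \<delta> * (u0 x - E)))"

lemma lamb_gap_continuous_u0:
  "admissible u0 \<Longrightarrow> continuous_on A (\<lambda>x. lamb_gap (2 * \<delta> * (u0 x - E)))"
  by (intro continuous_on_compose2[OF continuous_lamb_gap] continuous_intros admissible_continuous) auto

text \<open>A majorant independent of E: monotonicity reduces to E = 0, the Hoelder bound leaves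
  terms in sqrt u0 and u0, and u0 \<le> sqrt (umax) sqrt u0 absorbs the second. This is where
  integrability of sqrt u0 enters.\<close>

lemma lamb_gap_bound:
  assumes \<delta>: "0 < \<delta>" and u: "admissible u0" and E: "0 \<le> E"
  shows "norm (lamb_gap (2 * \<delta> * (u0 x - E))) \<le> (4 * sqrt (2 * \<delta>) + 2 * \<delta> * sqrt (umax u0)) * sqrt (u0 x)"
proof -
  have p: "0 < u0 x" using u by (simp add: admissible_def)
  have "lamb_gap (2 * \<delta> * (u0 x - E)) \<le> lamb_gap (2 * \<delta> * u0 x)"
    using \<delta> E by (intro lamb_gap_mono mult_left_mono) auto
  also have "\<dots> \<le> 4 * sqrt (2 * \<delta> * u0 x) + 2 * \<delta> * u0 x"
    using lamb_gap_diff[of "2 * \<delta> * u0 x" 0] lamb_gap_nonpos[of 0] \<delta> p by simp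
  also have "\<dots> = 4 * sqrt (2 * \<delta>) * sqrt (u0 x) + 2 * \<delta> * (sqrt (u0 x) * sqrt (u0 x))"
    using p by (simp add: real_sqrt_mult)
  also have "\<dots> \<le> 4 * sqrt (2 * \<delta>) * sqrt (u0 x) + 2 * \<delta> * (sqrt (umax u0) * sqrt (u0 x))"
    using p \<delta> admissible_max(1)[OF u, of x] by (intro add_left_mono mult_left_mono mult_right_mono) auto
  finally show ?thesis using lamb_gap_nonneg by (simp add: algebra_simps)
qed

context
  fixes \<delta> :: real and u0 :: "real \<Rightarrow> real"
  assumes \<delta>: "0 < \<delta>" and u: "admissible u0" and sq: "(\<lambda>x. sqrt (u0 x)) integrable_on UNIV"
begin

lemma lamb_gap_integrable:
  assumes "0 \<le> E"
  shows "(\<lambda>x. lamb_gap (2 * \<delta> * (u0 x - E))) integrable_on UNIV"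
proof (rule measurable_bounded_by_integrable_imp_integrable)
  show "(\<lambda>x. lamb_gap (2 * \<delta> * (u0 x - E))) \<in> borel_measurable (lebesgue_on UNIV)"
    by (intro continuous_imp_measurable_on_sets_lebesgue lamb_gap_continuous_u0 u) auto
  show "(\<lambda>x. (4 * sqrt (2 * \<delta>) + 2 * \<delta> * sqrt (umax u0)) * sqrt (u0 x)) integrable_on UNIV"
    using sq by (rule integrable_on_mult_right)
qed (use lamb_gap_bound[OF \<delta> u assms] in auto)

lemma continuous_lamb_int: "continuous_on {0..} (lamb_int \<delta> u0)"
proof (rule continuous_on_sequentiallyI)
  fix s E assume s: "\<forall>n. s n \<in> {0::real..}" "E \<in> {0..}" "s \<longlonglongrightarrow> E"
  show "(\<lambda>n. lamb_int \<delta> u0 (s n)) \<longlonglongrightarrow> lamb_int \<delta> u0 E"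
    unfolding lamb_int_def
  proof (rule dominated_convergence(2))
    show "(\<lambda>x. (4 * sqrt (2 * \<delta>) + 2 * \<delta> * sqrt (umax u0)) * sqrt (u0 x)) integrable_on UNIV"
      using sq by (rule integrable_on_mult_right)
    fix x
    have "isCont lamb_gap y" for y
      using continuous_lamb_gap by (simp add: continuous_on_eq_continuous_at)
    then show "(\<lambda>k. lamb_gap (2 * \<delta> * (u0 x - s k))) \<longlonglongrightarrow> lamb_gap (2 * \<delta> * (u0 x - E))"
      by (rule isCont_tendsto_compose) (intro tendsto_intros s)
  qed (use s lamb_gap_integrable lamb_gap_bound[OF \<delta> u] in auto)
qed

lemma lamb_int_strict_antimono:
  assumes "0 \<le> E" "E < E'" "E < umax u0"
  shows "lamb_int \<delta> u0 E' < lamb_int \<delta> u0 E"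
proof -
  define f where "f = (\<lambda>x. lamb_gap (2 * \<delta> * (u0 x - E)) - lamb_gap (2 * \<delta> * (u0 x - E')))"
  have f: "f integrable_on UNIV"
    unfolding f_def using assms by (intro integrable_diff lamb_gap_integrable) auto
  have f0: "0 \<le> f x" for x
    unfolding f_def using lamb_gap_mono[of "2 * \<delta> * (u0 x - E')" "2 * \<delta> * (u0 x - E)"] assms \<delta> by simp
  have cont: "continuous_on A f" for A
    unfolding f_def by (intro continuous_intros lamb_gap_continuous_u0 u)
  \<comment> \<open>For a strict inequality of integrals it suffices that the nonnegative continuous
    difference f is positive at one point. This holds at \<open>xmax\<close> because E <
    \<open>umax\<close>; the unit length is arbitrary.\<close>
  let ?I = "{xmax u0 .. xmax u0 + 1}"
  have "0 < f (xmax u0)"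
    unfolding f_def
    using lamb_gap_strict[of "2 * \<delta> * (u0 (xmax u0) - E')" "2 * \<delta> * (u0 (xmax u0) - E)"] assms \<delta>
    by (simp add: umax_def)
  moreover have "integral ?I f \<noteq> 0 \<or> f (xmax u0) = 0"
  proof (rule disjCI)
    assume "\<not> f (xmax u0) = 0"
    show "integral ?I f \<noteq> 0"
    proof
      assume "integral ?I f = 0"
      then have "(f has_integral 0) (cbox (xmax u0) (xmax u0 + 1))"
        using integrable_integral[OF integrable_continuous_real[OF cont]] by (metis box_real(2))
      then have "f (xmax u0) = 0"
        using has_integral_0_cbox_imp_0[of "xmax u0" "xmax u0 + 1" f "xmax u0"] cont f0 by simp
      with \<open>\<not> f (xmax u0) = 0\<close> show False by simp
    qed
  qed
  moreover have "0 \<le> integral ?I f"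
    by (intro integral_nonneg integrable_continuous_real cont f0)
  ultimately have "0 < integral ?I f" by auto
  also have "\<dots> \<le> integral UNIV f"
    by (intro integral_subset_le integrable_continuous_real cont f) (auto simp: f0)
  also have "\<dots> = lamb_int \<delta> u0 E - lamb_int \<delta> u0 E'"
    unfolding f_def lamb_int_def using assms by (intro integral_diff lamb_gap_integrable) auto
  finally show ?thesis by simp
qed

lemma lamb_int_umax: "lamb_int \<delta> u0 (umax u0) = 0"
proof -
  have "2 * \<delta> * (u0 x - umax u0) \<le> 0" for x
    using \<delta> admissible_max(1)[OF u, of x] by (simp add: mult_le_0_iff)
  then show ?thesis by (simp add: lamb_int_def lamb_gap_nonpos)
qed

lemma two_delta_less_pi:
  assumes "k \<le> kmax \<delta> u0"
  shows "2 * \<delta> * k < pi"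
proof -
  have "2 * \<delta> * k \<le> 2 * \<delta> * kmax \<delta> u0" using assms \<delta> by (intro mult_left_mono) auto
  also have "\<dots> < pi" by (rule kmax_efun[OF \<delta> admissible_max(3)[OF u]])
  finally show ?thesis .
qed

lemma Ek_strict_mono:
  assumes "0 \<le> k" "k < k'" "2 * \<delta> * k' < pi"
  shows "Ek \<delta> k < Ek \<delta> k'"
proof -
  have "2 * \<delta> * k < 2 * \<delta> * k'" using assms \<delta> by simp
  moreover from this assms(3) have "2 * \<delta> * k < pi" by (rule order.strict_trans)
  ultimately have "2 * \<delta> * k < pi" "efun (2 * \<delta> * k) < efun (2 * \<delta> * k')"
    using efun_strict_mono[of "2 * \<delta> * k" "2 * \<delta> * k'"] assms \<delta> by auto
  with assms \<delta> show ?thesis by (simp add: Ek_efun divide_strict_right_mono)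
qed

lemma continuous_Ek: "continuous_on {0..kmax \<delta> u0} (Ek \<delta>)"
proof -
  have lt: "2 * \<delta> * k < pi" if "k \<in> {0..kmax \<delta> u0}" for k
    using that two_delta_less_pi by simp
  have "continuous_on {0..kmax \<delta> u0} (\<lambda>k. efun (2 * \<delta> * k) / (2 * \<delta>))"
    using \<delta> lt two_delta_less_pi[of "kmax \<delta> u0"] by (intro continuous_intros continuous_on_compose2[OF continuous_efun]) auto
  then show ?thesis
    by (rule continuous_on_eq) (use lt \<delta> in \<open>auto simp: Ek_efun\<close>)
qed

lemma Rwyl_lamb_int:
  assumes "0 \<le> k" "k < kmax \<delta> u0"
  shows "Rwyl \<delta> u0 k = 1 / (4 * \<delta>) * lamb_int \<delta> u0 (Ek \<delta> k)" "0 \<le> Ek \<delta> k" "Ek \<delta> k < umax u0"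
proof -
  note km = kmax_efun[OF \<delta> admissible_max(3)[OF u]]
  have lt: "2 * \<delta> * k < pi" using assms by (intro two_delta_less_pi) simp
  have E0: "Ek \<delta> 0 = 0" using \<delta> by (simp add: Ek_efun efun_def)
  show E: "0 \<le> Ek \<delta> k" using Ek_strict_mono[of 0 k] assms lt E0 by (cases "k = 0") auto
  show E': "Ek \<delta> k < umax u0" using Ek_strict_mono[of k "kmax \<delta> u0"] assms km by simp
  let ?S = "if k = 0 then UNIV else {xminus \<delta> u0 k..xplus \<delta> u0 k}"
  \<comment> \<open>At \<kappa> = 0 the level is 0, and positivity of u0 makes the superlevel set
    the whole line, in agreement with the infinite turning points.\<close>
  have S: "x \<in> ?S \<longleftrightarrow> Ek \<delta> k \<le> u0 x" for x
  proof (cases "k = 0")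
    case True
    then show ?thesis using E0 u by (simp add: admissible_def less_imp_le)
  next
    case False
    then have "0 < Ek \<delta> k" using Ek_strict_mono[of 0 k] assms lt E0 by simp
    then show ?thesis using superlevel_set[OF u _ E' refl, of x] False by simp
  qed
  have "((\<lambda>x. lamb_gap (2 * \<delta> * (u0 x - Ek \<delta> k))) has_integral lamb_int \<delta> u0 (Ek \<delta> k)) UNIV"
    unfolding lamb_int_def using lamb_gap_integrable[OF E] by (rule integrable_integral)
  also have "(\<lambda>x. lamb_gap (2 * \<delta> * (u0 x - Ek \<delta> k))) = (\<lambda>x. if x \<in> ?S then lamb_gap (2 * \<delta> * (u0 x - Ek \<delta> k)) else 0)"
    using \<delta> by (intro ext) (auto simp: S mult_le_0_iff intro!: lamb_gap_nonpos)
  finally have "((\<lambda>x. lamb_gap (2 * \<delta> * (u0 x - Ek \<delta> k))) has_integral lamb_int \<delta> u0 (Ek \<delta> k)) ?S"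
    by (simp only: has_integral_restrict_UNIV)
  then have "((\<lambda>x. complex_of_real (lamb_gap (2 * \<delta> * (u0 x - Ek \<delta> k)))) has_integral complex_of_real (lamb_int \<delta> u0 (Ek \<delta> k))) ?S"
    by (rule has_integral_of_real)
  moreover have "complex_of_real (lamb_gap (2 * \<delta> * (u0 x - Ek \<delta> k))) = W0 (aa \<delta> k (u0 x)) - Wm1 (aa \<delta> k (u0 x))"
    if "x \<in> ?S" for x
    unfolding aa_eq[OF \<delta> assms(1) lt] using that \<delta> unfolding S by (subst lamb_gap_eq) auto
  ultimately have "((\<lambda>x. W0 (aa \<delta> k (u0 x)) - Wm1 (aa \<delta> k (u0 x))) has_integral complex_of_real (lamb_int \<delta> u0 (Ek \<delta> k))) ?S"
    by (rule has_integral_eq[rotated])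
  then show "Rwyl \<delta> u0 k = 1 / (4 * \<delta>) * lamb_int \<delta> u0 (Ek \<delta> k)"
    unfolding Rwyl_def by (simp add: integral_unique)
qed

lemma Rwyl_0_pos: "0 < Rwyl \<delta> u0 0"
proof -
  note km = kmax_efun[OF \<delta> admissible_max(3)[OF u]]
  have "lamb_int \<delta> u0 (umax u0) < lamb_int \<delta> u0 (Ek \<delta> 0)"
    using Rwyl_lamb_int(2,3)[of 0] km by (intro lamb_int_strict_antimono) auto
  then show ?thesis using Rwyl_lamb_int(1)[of 0] km \<delta> by (simp add: lamb_int_umax)
qed

lemma Rwyl_strict_antimono:
  assumes "0 \<le> k" "k < k'" "k' < kmax \<delta> u0"
  shows "Rwyl \<delta> u0 k' < Rwyl \<delta> u0 k"
proof -
  have "2 * \<delta> * k' < pi" using assms by (intro two_delta_less_pi) simp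
  then have "lamb_int \<delta> u0 (Ek \<delta> k') < lamb_int \<delta> u0 (Ek \<delta> k)"
    using assms Rwyl_lamb_int(2,3)[of k] by (intro lamb_int_strict_antimono Ek_strict_mono) auto
  then show ?thesis using Rwyl_lamb_int(1)[of k] Rwyl_lamb_int(1)[of k'] assms \<delta> by (simp add: divide_strict_right_mono)
qed

lemma Rwyl_level:
  assumes "0 < c" "c < Rwyl \<delta> u0 0"
  shows "\<exists>!k. 0 < k \<and> k < kmax \<delta> u0 \<and> Rwyl \<delta> u0 k = c"
proof (rule ex_ex1I)
  note km = kmax_efun[OF \<delta> admissible_max(3)[OF u]]
  have E0: "Ek \<delta> 0 = 0" using \<delta> by (simp add: Ek_efun efun_def)
  \<comment> \<open>The level is found first in the variable E, where dominated convergence gives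
    continuity, and then carried back to k through \<open>Ek\<close>. Strictness of 0 < c and c <
    R(0) excludes the endpoints \<open>kmax\<close> and 0.\<close>
  have "\<exists>E\<ge>0. E \<le> umax u0 \<and> lamb_int \<delta> u0 E = 4 * \<delta> * c"
  proof (rule IVT2')
    show "continuous_on {0..umax u0} (lamb_int \<delta> u0)"
      by (rule continuous_on_subset[OF continuous_lamb_int]) auto
    show "4 * \<delta> * c \<le> lamb_int \<delta> u0 0"
      using assms(2) Rwyl_lamb_int(1)[of 0] km \<delta> by (simp add: E0 field_simps)
  qed (use assms \<delta> lamb_int_umax admissible_max(3)[OF u] in auto)
  then obtain E where E: "0 \<le> E" "E \<le> umax u0" "lamb_int \<delta> u0 E = 4 * \<delta> * c" by blast
  have "\<exists>k\<ge>0. k \<le> kmax \<delta> u0 \<and> Ek \<delta> k = E"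
    by (rule IVT') (use E km E0 continuous_Ek in auto)
  then obtain k where k: "0 \<le> k" "k \<le> kmax \<delta> u0" "Ek \<delta> k = E" by blast
  have "k \<noteq> kmax \<delta> u0" using km(3) k E(3) lamb_int_umax assms \<delta> by auto
  then have R: "Rwyl \<delta> u0 k = c" using Rwyl_lamb_int(1)[of k] k E \<delta> by simp
  with assms(2) have "k \<noteq> 0" by auto
  with k \<open>k \<noteq> kmax \<delta> u0\<close> have "0 < k" "k < kmax \<delta> u0" by auto
  with R show "\<exists>k. 0 < k \<and> k < kmax \<delta> u0 \<and> Rwyl \<delta> u0 k = c" by blast
next
  fix k k'
  assume "0 < k \<and> k < kmax \<delta> u0 \<and> Rwyl \<delta> u0 k = c" "0 < k' \<and> k' < kmax \<delta> u0 \<and> Rwyl \<delta> u0 k' = c"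
  then show "k = k'"
    using Rwyl_strict_antimono[of k k'] Rwyl_strict_antimono[of k' k] by (cases k k' rule: linorder_cases) auto
qed

lemma epsN_pos: "1 \<le> N \<Longrightarrow> 0 < epsN \<delta> u0 N"
  using Rwyl_0_pos by (simp add: epsN_def)

lemma kap:
  assumes "n \<in> {1..N}"
  shows "0 < kap \<delta> u0 N n" "kap \<delta> u0 N n < kmax \<delta> u0"
    "Rwyl \<delta> u0 (kap \<delta> u0 N n) = pi * (real n - 1 / 2) * epsN \<delta> u0 N"
proof -
  have n: "1 \<le> n" "n \<le> N" using assms by auto
  have "\<exists>!k. 0 < k \<and> k < kmax \<delta> u0 \<and> Rwyl \<delta> u0 k = pi * (real n - 1 / 2) * epsN \<delta> u0 N"
  proof (rule Rwyl_level)
    show "0 < pi * (real n - 1 / 2) * epsN \<delta> u0 N"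
      using n epsN_pos[of N] by (intro mult_pos_pos) auto
    \<comment> \<open>The n-th level is the fraction (n - 1/2) / N of R(0); the half-integer shift
      keeps it strictly inside the range even for n = N.\<close>
    have "pi * (real n - 1 / 2) * epsN \<delta> u0 N = (real n - 1 / 2) / real N * Rwyl \<delta> u0 0"
      using n by (simp add: epsN_def)
    also have "\<dots> < 1 * Rwyl \<delta> u0 0"
      using n by (intro mult_strict_right_mono Rwyl_0_pos) (simp add: field_simps)
    finally show "pi * (real n - 1 / 2) * epsN \<delta> u0 N < Rwyl \<delta> u0 0" by simp
  qed
  from theI'[OF this] show "0 < kap \<delta> u0 N n" "kap \<delta> u0 N n < kmax \<delta> u0"
    "Rwyl \<delta> u0 (kap \<delta> u0 N n) = pi * (real n - 1 / 2) * epsN \<delta> u0 N"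
    by (auto simp: kap_def)
qed

text \<open>Equal parameters would have equal levels. This supplies the distinct nodes that the
  Cauchy expansion asks for.\<close>

lemma inj_on_kap: "inj_on (kap \<delta> u0 N) {1..N}"
proof (rule inj_onI)
  fix n m assume nm: "n \<in> {1..N}" "m \<in> {1..N}" "kap \<delta> u0 N n = kap \<delta> u0 N m"
  then have "pi * (real n - 1 / 2) * epsN \<delta> u0 N = pi * (real m - 1 / 2) * epsN \<delta> u0 N"
    using kap(3)[of n N] kap(3)[of m N] by metis
  moreover have "0 < epsN \<delta> u0 N" using nm(1) by (intro epsN_pos) auto
  ultimately show "n = m" by auto
qed

lemma Im_zn: "n \<in> {1..N} \<Longrightarrow> Im (zn \<delta> u0 N n) = kap \<delta> u0 N n"
  using kap(1)[of n N] by (simp add: zn_def zeta_def)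

end

section \<open>Determinants of perturbed Cauchy matrices\<close>

text \<open>One step of elimination as a product: \<open>U\<close> is unit upper triangular, and
  \<open>L\<close> has first row (f(0,0), 0, ..., 0) with the Schur complement as its remaining
  block.\<close>

lemma det_schur_first:
  fixes f :: "nat \<times> nat \<Rightarrow> 'a :: field"
  assumes "f (0, 0) \<noteq> 0"
  shows "det (mat (Suc n) (Suc n) f) =
    f (0, 0) * det (mat n n (\<lambda>(i, j). f (Suc i, Suc j) - f (Suc i, 0) * f (0, Suc j) / f (0, 0)))"
proof -
  define S where "S = (\<lambda>(i, j). f (Suc i, Suc j) - f (Suc i, 0) * f (0, Suc j) / f (0, 0))"
  define L where "L = mat (Suc n) (Suc n) (\<lambda>(i, j). if j = 0 then f (i, 0) else if i = 0 then 0 else S (i - 1, j - 1))"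
  define U where "U = mat (Suc n) (Suc n) (\<lambda>(i, j). if i = 0 then f (0, j) / f (0, 0) else if i = j then 1 else 0)"
  have L: "L \<in> carrier_mat (Suc n) (Suc n)" and U: "U \<in> carrier_mat (Suc n) (Suc n)"
    by (auto simp: L_def U_def)
  have "mat (Suc n) (Suc n) f = L * U"
  proof (rule eq_matI)
    fix i j assume "i < dim_row (L * U)" "j < dim_col (L * U)"
    then have ij: "i < Suc n" "j < Suc n" using L U by auto
    have "(L * U) $$ (i, j) = (\<Sum>k = 0..<Suc n. L $$ (i, k) * U $$ (k, j))"
      using ij L U by (simp add: scalar_prod_def)
    also have "\<dots> = L $$ (i, 0) * U $$ (0, j) + (\<Sum>k = 0..<n. L $$ (i, Suc k) * U $$ (Suc k, j))"
      by (subst sum.atLeast0_lessThan_Suc_shift) simp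
    also have "(\<Sum>k = 0..<n. L $$ (i, Suc k) * U $$ (Suc k, j))
        = (\<Sum>k = 0..<n. if Suc k = j then L $$ (i, j) else 0)"
      using ij by (intro sum.cong) (auto simp: U_def)
    also have "\<dots> = (if j = 0 then 0 else L $$ (i, j))"
      using ij by (cases j) auto
    also have "L $$ (i, 0) * U $$ (0, j) + \<dots> = f (i, j)"
      using ij assms by (cases i; cases j) (auto simp: L_def U_def S_def)
    finally show "mat (Suc n) (Suc n) f $$ (i, j) = (L * U) $$ (i, j)" using ij by simp
  qed (use L U in auto)
  then have "det (mat (Suc n) (Suc n) f) = det L * det U"
    using det_mult[OF L U] by simp
  moreover have "det U = 1"
  proof -
    have "upper_triangular U" by (auto simp: U_def)
    from det_upper_triangular[OF this U] have "det U = prod_list (diag_mat U)" .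
    also have "diag_mat U = replicate (Suc n) 1"
      using assms by (intro nth_equalityI) (auto simp: diag_mat_def U_def nth_append simp del: upt_Suc replicate_Suc)
    finally show ?thesis by simp
  qed
  moreover have "det L = f (0, 0) * det (mat n n S)"
  proof -
    have "det L = (\<Sum>j<Suc n. L $$ (0, j) * cofactor L 0 j)"
      using laplace_expansion_row[OF L, of 0] by simp
    also have "\<dots> = L $$ (0, 0) * cofactor L 0 0"
      by (subst sum.lessThan_Suc_shift) (simp add: L_def)
    also have "mat_delete L 0 0 = mat n n S"
      by (rule eq_matI) (auto simp: mat_delete_def L_def)
    then have "cofactor L 0 0 = det (mat n n S)" by (simp add: cofactor_def)
    finally show ?thesis by (simp add: L_def)
  qed
  ultimately show ?thesis by (simp add: S_def)
qed

text \<open>Linearity in the first row splits off the 1 in the corner. In the subset expansion the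
  first summand carries the index sets without 0, and the second, after elimination, those
  containing 0.\<close>

lemma det_one_plus_step:
  fixes c :: "nat \<Rightarrow> nat \<Rightarrow> 'a :: field"
  assumes "c 0 0 \<noteq> 0"
  shows "det (mat (Suc n) (Suc n) (\<lambda>(i, j). (if i = j then 1 else 0) + c i j)) =
    det (mat n n (\<lambda>(i, j). (if i = j then 1 else 0) + c (Suc i) (Suc j)))
    + c 0 0 * det (mat n n (\<lambda>(i, j). (if i = j then 1 else 0) + (c (Suc i) (Suc j) - c (Suc i) 0 * c 0 (Suc j) / c 0 0)))"
    (is "det ?A = det ?B + _")
proof -
  define f where "f = (\<lambda>(i, j). (if i = j \<and> i \<noteq> 0 then 1 else 0) + c i j)"
  let ?F = "mat (Suc n) (Suc n) f"
  have del: "mat_delete ?A 0 j = mat_delete ?F 0 j" for j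
    by (rule eq_matI) (auto simp: mat_delete_def f_def)
  have "det ?A = (\<Sum>j<Suc n. ?A $$ (0, j) * cofactor ?A 0 j)"
    using laplace_expansion_row[of ?A "Suc n" 0] by simp
  also have "\<dots> = (\<Sum>j<Suc n. (if j = 0 then cofactor ?F 0 0 else 0) + ?F $$ (0, j) * cofactor ?F 0 j)"
    by (intro sum.cong) (auto simp only: cofactor_def del, auto simp: f_def distrib_right)
  also have "\<dots> = cofactor ?F 0 0 + det ?F"
    using laplace_expansion_row[of ?F "Suc n" 0] by (simp add: sum.distrib del: sum.lessThan_Suc)
  also have "mat_delete ?F 0 0 = ?B"
    by (rule eq_matI) (auto simp: mat_delete_def f_def)
  then have "cofactor ?F 0 0 = det ?B" by (simp add: cofactor_def)
  also have "det ?F = c 0 0 * det (mat n n (\<lambda>(i, j). (if i = j then 1 else 0) + (c (Suc i) (Suc j) - c (Suc i) 0 * c 0 (Suc j) / c 0 0)))"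
    by (subst det_schur_first) (use assms in \<open>auto simp: f_def intro!: arg_cong[where f = det] eq_matI\<close>)
  finally show ?thesis .
qed

lemma sum_Pow_lessThan_Suc:
  "(\<Sum>S\<in>Pow {..<Suc n}. f S) = (\<Sum>S\<in>Pow {..<n}. f (Suc ` S)) + (\<Sum>S\<in>Pow {..<n}. f (insert 0 (Suc ` S)))"
proof -
  have P: "Pow {..<Suc n} = (image Suc) ` Pow {..<n} \<union> (\<lambda>S. insert 0 (Suc ` S)) ` Pow {..<n}"
    unfolding lessThan_Suc_eq_insert_0 Pow_insert by (simp add: image_image image_Pow_surj[OF refl, symmetric])
  have inj1: "inj_on (image Suc) (Pow {..<n})"
    by (intro inj_onI) (simp add: inj_image_eq_iff)
  have inj2: "inj_on (\<lambda>S. insert 0 (Suc ` S)) (Pow {..<n})"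
  proof (intro inj_onI)
    fix A B :: "nat set" assume "insert 0 (Suc ` A) = insert 0 (Suc ` B)"
    then have "Suc ` A = Suc ` B" by (auto dest!: insert_ident[THEN iffD1, rotated 2])
    then show "A = B" by (simp add: inj_image_eq_iff)
  qed
  show ?thesis
    unfolding P
    by (subst sum.union_disjoint)
       (auto simp: sum.reindex[OF inj1] sum.reindex[OF inj2])
qed

text \<open>The Schur complement of a diagonally rescaled Cauchy matrix is again one: only the two
  diagonal factors change.\<close>

lemma det_one_plus_cauchy:
  fixes a b w :: "nat \<Rightarrow> complex"
  assumes "\<And>i. i < n \<Longrightarrow> 0 < Im (w i)" "inj_on w {..<n}"
    and "\<And>i. i < n \<Longrightarrow> a i \<noteq> 0" "\<And>i. i < n \<Longrightarrow> b i \<noteq> 0"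
  shows "det (mat n n (\<lambda>(i, j). (if i = j then 1 else 0) + a i * (\<i> / (w j - cnj (w i))) * b j)) =
    (\<Sum>S\<in>Pow {..<n}. (\<Prod>i\<in>S. a i * b i / (2 * Im (w i))) *
       (\<Prod>i\<in>S. \<Prod>j\<in>S - {i}. complex_of_real (cmod ((w i - w j) / (w i - cnj (w j))))))"
  using assms
proof (induction n arbitrary: a b w)
  case 0
  show ?case by simp
next
  case (Suc n)
  define c where "c = (\<lambda>i j. a i * (\<i> / (w j - cnj (w i))) * b j)"
  \<comment> \<open>The left and right factors produced by elimination differ even if a = b
    initially. This is why the induction runs over two independent diagonals.\<close>
  define a' where "a' = (\<lambda>i. a (Suc i) * ((cnj (w 0) - cnj (w (Suc i))) / (w 0 - cnj (w (Suc i)))))"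
  define b' where "b' = (\<lambda>j. b (Suc j) * ((w (Suc j) - w 0) / (w (Suc j) - cnj (w 0))))"
  define w' where "w' = (\<lambda>j. w (Suc j))"
  define g where "g = (\<lambda>i j. complex_of_real (cmod ((w i - w j) / (w i - cnj (w j)))))"
  have ne: "w i - cnj (w j) \<noteq> 0" if "i < Suc n" "j < Suc n" for i j
  proof
    assume "w i - cnj (w j) = 0"
    then have "Im (w i - cnj (w j)) = 0" by simp
    with Suc.prems(1)[OF that(1)] Suc.prems(1)[OF that(2)] show False by simp
  qed
  have ww: "w i \<noteq> w j" if "i < Suc n" "j < Suc n" "i \<noteq> j" for i j
    using Suc.prems(2) that by (auto dest: inj_onD)
  have c00: "c 0 0 = a 0 * b 0 / (2 * Im (w 0))"
    by (simp add: c_def complex_diff_cnj)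
  have "c 0 0 \<noteq> 0" using Suc.prems(1)[of 0] Suc.prems(3)[of 0] Suc.prems(4)[of 0] by (simp add: c00)
  have schur: "c (Suc i) (Suc j) - c (Suc i) 0 * c 0 (Suc j) / c 0 0 = a' i * (\<i> / (w' j - cnj (w' i))) * b' j"
    if "i < n" "j < n" for i j
  proof -
    \<comment> \<open>The instance used is (w_0 - cnj w_i)(w_j - cnj w_0) - (w_0 - cnj w_0)(w_j -
      cnj w_i) = (cnj w_0 - cnj w_i)(w_j - w_0), with indices counted in the larger matrix.\<close>
    have key: "inverse X - Y * inverse Z * inverse V = inverse X * (p * inverse Z) * (q * inverse V)"
      if "X \<noteq> 0" "Z \<noteq> 0" "V \<noteq> 0" "Z * V - Y * X = p * q" for X Y Z V p q :: complex
    proof -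
      have "inverse X - Y * inverse Z * inverse V = (Z * V - Y * X) * (inverse X * inverse Z * inverse V)"
        using that(1-3) by (simp add: field_simps)
      then show ?thesis unfolding that(4) by (simp only: mult_ac)
    qed
    have "inverse (w (Suc j) - cnj (w (Suc i))) - (w 0 - cnj (w 0)) * inverse (w 0 - cnj (w (Suc i))) * inverse (w (Suc j) - cnj (w 0))
      = inverse (w (Suc j) - cnj (w (Suc i))) * ((cnj (w 0) - cnj (w (Suc i))) * inverse (w 0 - cnj (w (Suc i))))
         * ((w (Suc j) - w 0) * inverse (w (Suc j) - cnj (w 0)))"
      using that by (intro key ne) (auto simp: algebra_simps)
    moreover have "c (Suc i) (Suc j) - c (Suc i) 0 * c 0 (Suc j) / c 0 0 = a (Suc i) * \<i> * b (Suc j) *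
       (inverse (w (Suc j) - cnj (w (Suc i))) - (w 0 - cnj (w 0)) * inverse (w 0 - cnj (w (Suc i))) * inverse (w (Suc j) - cnj (w 0)))"
      using ne[of 0 0] ne[of "Suc j" 0] ne[of 0 "Suc i"] ne[of "Suc j" "Suc i"] that Suc.prems(3)[of 0] Suc.prems(4)[of 0]
      unfolding c_def by (simp add: divide_simps) (simp add: algebra_simps)
    ultimately show ?thesis by (simp add: a'_def b'_def w'_def divide_inverse mult_ac)
  qed
  \<comment> \<open>Separately the new factors are complex, but their product is a squared modulus.
    It is written as g(0,i) g(i,0) so that both orders of the pair appear in the double
    product.\<close>
  have ab': "a' i * b' i = a (Suc i) * b (Suc i) * (g 0 (Suc i) * g (Suc i) 0)" if "i < n" for i
  proof -
    have n1: "w 0 - cnj (w (Suc i)) \<noteq> 0" "w (Suc i) - cnj (w 0) \<noteq> 0" using ne that by auto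
    have cm: "cmod (w (Suc i) - cnj (w 0)) = cmod (w 0 - cnj (w (Suc i)))"
      by (metis complex_cnj_cnj complex_cnj_diff complex_mod_cnj norm_minus_commute)
    have e1: "complex_of_real (cmod (w 0 - w (Suc i))) ^ 2 = - ((cnj (w 0) - cnj (w (Suc i))) * (w (Suc i) - w 0))"
      using complex_norm_square[of "w 0 - w (Suc i)"] by (simp add: algebra_simps)
    have e2: "complex_of_real (cmod (w 0 - cnj (w (Suc i)))) ^ 2 = - ((w 0 - cnj (w (Suc i))) * (w (Suc i) - cnj (w 0)))"
      using complex_norm_square[of "w 0 - cnj (w (Suc i))"] by (simp add: algebra_simps)
    have "g 0 (Suc i) * g (Suc i) 0 = complex_of_real (cmod (w 0 - w (Suc i))) ^ 2 / complex_of_real (cmod (w 0 - cnj (w (Suc i)))) ^ 2"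
      by (simp add: g_def norm_divide cm norm_minus_commute[of "w (Suc i)" "w 0"] power2_eq_square)
    also have "\<dots> = (cnj (w 0) - cnj (w (Suc i))) / (w 0 - cnj (w (Suc i))) * ((w (Suc i) - w 0) / (w (Suc i) - cnj (w 0)))"
      unfolding e1 e2 by simp
    finally show ?thesis by (simp add: a'_def b'_def)
  qed
  have IH1: "det (mat n n (\<lambda>(i, j). (if i = j then 1 else 0) + c (Suc i) (Suc j))) =
    (\<Sum>S\<in>Pow {..<n}. (\<Prod>i\<in>S. a (Suc i) * b (Suc i) / (2 * Im (w (Suc i)))) * (\<Prod>i\<in>S. \<Prod>j\<in>S - {i}. g (Suc i) (Suc j)))"
    unfolding c_def g_def
    by (rule Suc.IH[of "\<lambda>i. w (Suc i)" "\<lambda>i. a (Suc i)" "\<lambda>i. b (Suc i)"]) (use Suc.prems in \<open>auto simp: inj_on_def\<close>)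
  have IH2: "det (mat n n (\<lambda>(i, j). (if i = j then 1 else 0) + a' i * (\<i> / (w' j - cnj (w' i))) * b' j)) =
    (\<Sum>S\<in>Pow {..<n}. (\<Prod>i\<in>S. a' i * b' i / (2 * Im (w (Suc i)))) * (\<Prod>i\<in>S. \<Prod>j\<in>S - {i}. g (Suc i) (Suc j)))"
    unfolding g_def w'_def
    by (rule Suc.IH[of "\<lambda>i. w (Suc i)" a' b']) (use Suc.prems ne ww in \<open>auto simp: inj_on_def a'_def b'_def\<close>)
  have "det (mat (Suc n) (Suc n) (\<lambda>(i, j). (if i = j then 1 else 0) + c i j)) =
    det (mat n n (\<lambda>(i, j). (if i = j then 1 else 0) + c (Suc i) (Suc j)))
    + c 0 0 * det (mat n n (\<lambda>(i, j). (if i = j then 1 else 0) + (c (Suc i) (Suc j) - c (Suc i) 0 * c 0 (Suc j) / c 0 0)))"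
    by (rule det_one_plus_step) fact
  also have "mat n n (\<lambda>(i, j). (if i = j then 1 else 0) + (c (Suc i) (Suc j) - c (Suc i) 0 * c 0 (Suc j) / c 0 0))
     = mat n n (\<lambda>(i, j). (if i = j then 1 else 0) + a' i * (\<i> / (w' j - cnj (w' i))) * b' j)"
    by (rule eq_matI) (auto simp: schur)
  also note IH2
  also note IH1
  also have "c 0 0 * (\<Sum>S\<in>Pow {..<n}. (\<Prod>i\<in>S. a' i * b' i / (2 * Im (w (Suc i)))) * (\<Prod>i\<in>S. \<Prod>j\<in>S - {i}. g (Suc i) (Suc j)))
    = (\<Sum>S\<in>Pow {..<n}. (\<Prod>i\<in>insert 0 (Suc ` S). a i * b i / (2 * Im (w i))) *
        (\<Prod>i\<in>insert 0 (Suc ` S). \<Prod>j\<in>insert 0 (Suc ` S) - {i}. g i j))"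
    unfolding sum_distrib_left
  proof (intro sum.cong refl)
    fix S assume "S \<in> Pow {..<n}"
    then have S: "S \<subseteq> {..<n}" and fin: "finite S" by (auto intro: finite_subset)
    have ins: "(\<Prod>j\<in>insert 0 (Suc ` S) - {Suc i}. g (Suc i) j) = g (Suc i) 0 * (\<Prod>j\<in>S - {i}. g (Suc i) (Suc j))" for i
    proof -
      have "insert 0 (Suc ` S) - {Suc i} = insert 0 (Suc ` (S - {i}))" by auto
      then show ?thesis using fin by (simp add: prod.reindex)
    qed
    have "insert 0 (Suc ` S) - {0} = Suc ` S" by auto
    then have ins0: "(\<Prod>j\<in>insert 0 (Suc ` S) - {0}. g 0 j) = (\<Prod>j\<in>S. g 0 (Suc j))"
      by (simp add: prod.reindex)
    have "(\<Prod>i\<in>insert 0 (Suc ` S). \<Prod>j\<in>insert 0 (Suc ` S) - {i}. g i j)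
      = (\<Prod>j\<in>insert 0 (Suc ` S) - {0}. g 0 j) * (\<Prod>i\<in>S. \<Prod>j\<in>insert 0 (Suc ` S) - {Suc i}. g (Suc i) j)"
      using fin by (subst prod.insert) (auto simp: prod.reindex)
    also have "\<dots> = (\<Prod>j\<in>S. g 0 (Suc j)) * ((\<Prod>i\<in>S. g (Suc i) 0) * (\<Prod>i\<in>S. \<Prod>j\<in>S - {i}. g (Suc i) (Suc j)))"
      unfolding ins ins0 by (simp add: prod.distrib)
    finally have split: "(\<Prod>i\<in>insert 0 (Suc ` S). \<Prod>j\<in>insert 0 (Suc ` S) - {i}. g i j)
      = (\<Prod>j\<in>S. g 0 (Suc j)) * ((\<Prod>i\<in>S. g (Suc i) 0) * (\<Prod>i\<in>S. \<Prod>j\<in>S - {i}. g (Suc i) (Suc j)))" .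
    have resc: "(\<Prod>i\<in>S. a' i * b' i / (2 * Im (w (Suc i))))
       = (\<Prod>i\<in>S. a (Suc i) * b (Suc i) / (2 * Im (w (Suc i)))) * ((\<Prod>i\<in>S. g 0 (Suc i)) * (\<Prod>i\<in>S. g (Suc i) 0))"
      unfolding prod.distrib[symmetric] using S by (intro prod.cong) (auto simp: ab')
    show "c 0 0 * ((\<Prod>i\<in>S. a' i * b' i / (2 * Im (w (Suc i)))) * (\<Prod>i\<in>S. \<Prod>j\<in>S - {i}. g (Suc i) (Suc j))) =
       (\<Prod>i\<in>insert 0 (Suc ` S). a i * b i / (2 * Im (w i))) *
        (\<Prod>i\<in>insert 0 (Suc ` S). \<Prod>j\<in>insert 0 (Suc ` S) - {i}. g i j)"
      unfolding split resc using fin by (simp add: prod.reindex c00)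
  qed
  also have "(\<Sum>S\<in>Pow {..<n}. (\<Prod>i\<in>S. a (Suc i) * b (Suc i) / (2 * Im (w (Suc i)))) * (\<Prod>i\<in>S. \<Prod>j\<in>S - {i}. g (Suc i) (Suc j)))
    = (\<Sum>S\<in>Pow {..<n}. (\<Prod>i\<in>Suc ` S. a i * b i / (2 * Im (w i))) * (\<Prod>i\<in>Suc ` S. \<Prod>j\<in>Suc ` S - {i}. g i j))"
  proof (intro sum.cong refl)
    fix S :: "nat set"
    have "Suc ` S - {Suc i} = Suc ` (S - {i})" for i by auto
    then show "(\<Prod>i\<in>S. a (Suc i) * b (Suc i) / (2 * Im (w (Suc i)))) * (\<Prod>i\<in>S. \<Prod>j\<in>S - {i}. g (Suc i) (Suc j))
      = (\<Prod>i\<in>Suc ` S. a i * b i / (2 * Im (w i))) * (\<Prod>i\<in>Suc ` S. \<Prod>j\<in>Suc ` S - {i}. g i j)"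
      by (simp add: prod.reindex)
  qed
  finally show ?case
    unfolding c_def g_def by (subst sum_Pow_lessThan_Suc) simp
qed

section \<open>Sectors and eigenvalues\<close>

text \<open>The sector \<open>\<bar>Arg w\<bar> \<le> h\<close> for \<open>h \<le> pi\<close>, written so that closure under addition is the
  triangle inequality (when \<open>cos h \<ge> 0\<close>).\<close>

definition halfcone :: "real \<Rightarrow> complex set" where
  "halfcone h = {w. cos h * cmod w \<le> Re w}"

lemma halfcone_0 [simp]: "0 \<in> halfcone h"
  by (simp add: halfcone_def)

lemma halfcone_add:
  assumes "0 \<le> cos h" "v \<in> halfcone h" "w \<in> halfcone h"
  shows "v + w \<in> halfcone h"
proof -
  have "cos h * cmod (v + w) \<le> cos h * (cmod v + cmod w)"
    by (intro mult_left_mono norm_triangle_ineq assms)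
  with assms show ?thesis by (simp add: halfcone_def algebra_simps)
qed

lemma halfcone_sum:
  assumes "0 \<le> cos h" "\<And>i. i \<in> A \<Longrightarrow> f i \<in> halfcone h"
  shows "sum f A \<in> halfcone h"
  using assms(2) by (induction A rule: infinite_finite_induct) (auto intro: halfcone_add assms(1))

lemma halfcone_scale: "0 \<le> r \<Longrightarrow> w \<in> halfcone h \<Longrightarrow> of_real r * w \<in> halfcone h"
  using mult_left_mono[of "cos h * cmod w" "Re w" r]
  by (simp add: halfcone_def norm_mult algebra_simps)

lemma cis_halfcone:
  assumes "\<bar>s\<bar> \<le> h" "h \<le> pi"
  shows "cis s \<in> halfcone h"
  using cos_monotone_0_pi_le[of "\<bar>s\<bar>" h] assms by (simp add: halfcone_def)

text \<open>Up to a nonnegative scale, inversion is conjugation, and the cone is symmetric under it.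
  For w = 0 the quotient is 0 by convention.\<close>

lemma halfcone_divide:
  assumes "w \<in> halfcone h" "0 \<le> p"
  shows "of_real p / w \<in> halfcone h"
proof (cases "w = 0")
  case False
  have "of_real p / w = of_real (p / (cmod w)\<^sup>2) * cnj w"
    using False by (simp add: complex_div_cnj[of "of_real p" w] cmod_power2[symmetric] field_simps)
  moreover have "cnj w \<in> halfcone h" using assms by (simp add: halfcone_def)
  ultimately show ?thesis using halfcone_scale[of "p / (cmod w)\<^sup>2" "cnj w" h] assms by simp
qed simp

lemma Arg_halfcone:
  assumes "w \<in> halfcone h" "w \<noteq> 0" "0 \<le> h" "h \<le> pi"
  shows "\<bar>Arg w\<bar> \<le> h"
proof -
  have "w = of_real (cmod w) * cis (Arg w)"
    using assms(2) by (simp add: Arg_eq cis_conv_exp)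
  then have "Re w = Re (of_real (cmod w) * cis (Arg w))" by (rule arg_cong)
  then have "Re w = cmod w * cos (Arg w)" by simp
  then have "cmod w * cos h \<le> cmod w * cos \<bar>Arg w\<bar>"
    using assms(1) by (simp add: halfcone_def mult.commute)
  then have "cos h \<le> cos \<bar>Arg w\<bar>" using assms(2) by simp
  then show ?thesis
    using cos_mono_le_eq[of h "\<bar>Arg w\<bar>"] assms Arg_bounded[of w] by auto
qed

lemma dfun_pos: "0 \<le> \<theta> \<Longrightarrow> \<theta> < pi \<Longrightarrow> 0 < dfun \<theta>"
  by (auto simp: dfun_def intro!: sin_gt_zero) 

text \<open>The distance from \<open>-1\<close> to the sector of opening \<open>\<theta> = 2 h\<close> bounded by the positive real
  axis is \<open>dfun \<theta>\<close>.\<close>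

lemma one_plus_sector:
  fixes m :: complex
  assumes h: "0 \<le> h" "2 * h < pi" and s: "s = 1 \<or> s = -1"
    and m: "m * cis (s * h) \<in> halfcone h"
  shows "1 + m \<noteq> 0" "dfun (2 * h) \<le> cmod (1 + m)"
    "0 \<le> - s * Arg (1 + m)" "- s * Arg (1 + m) \<le> 2 * h"
proof -
  have c0: "0 < cos h" using h by (intro cos_gt_zero_pi) auto
  \<comment> \<open>Rotation by s h makes the one-sided sector symmetric; undoing it measures the
    angle \<alpha> from the positive axis, clockwise for s = 1 and counterclockwise for s =
    -1.\<close>
  obtain \<rho> \<alpha> where \<rho>: "0 \<le> \<rho>" and \<alpha>: "0 \<le> \<alpha>" "\<alpha> \<le> 2 * h" and m_eq: "m = of_real \<rho> * cis (- s * \<alpha>)"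
  proof (cases "m = 0")
    case True
    then show ?thesis using that[of 0 0] h by simp
  next
    case False
    let ?k = "m * cis (s * h)"
    have "m = of_real (cmod m) * cis (- s * (h - s * Arg ?k))"
    proof -
      have "?k = of_real (cmod ?k) * cis (Arg ?k)"
        using False by (simp add: Arg_eq cis_conv_exp)
      then have "m = of_real (cmod ?k) * cis (Arg ?k) * cis (- (s * h))"
        by (metis (no_types, lifting) cis_mult add.right_inverse cis_zero mult.assoc mult.right_neutral)
      then show ?thesis using s by (auto simp: norm_mult cis_mult mult.assoc algebra_simps)
    qed
    moreover have "\<bar>Arg ?k\<bar> \<le> h" using m False h by (intro Arg_halfcone) auto
    ultimately show ?thesis using s that[of "cmod m" "h - s * Arg ?k"] by auto
  qed
  \<comment> \<open>The rotated 1 lies on an edge of the cone, so convexity keeps the rotated 1 + m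
    inside as well.\<close>
  have "1 * cis (s * h) \<in> halfcone h" using cis_halfcone[of "s * h" h] s h by auto
  then have q: "(1 + m) * cis (s * h) \<in> halfcone h"
    unfolding distrib_right using m c0 by (intro halfcone_add) auto
  have sq: "(cmod (1 + m))\<^sup>2 = (1 + \<rho> * cos \<alpha>)\<^sup>2 + (\<rho> * sin \<alpha>)\<^sup>2"
    using s by (auto simp: m_eq cmod_power2)
  also have "\<dots> = 1 + 2 * \<rho> * cos \<alpha> + \<rho>\<^sup>2 * ((sin \<alpha>)\<^sup>2 + (cos \<alpha>)\<^sup>2)" 
  proof -
    have "(1 + \<rho> * x)\<^sup>2 + (\<rho> * y)\<^sup>2 = 1 + 2 * \<rho> * x + \<rho>\<^sup>2 * (y\<^sup>2 + x\<^sup>2)" for x y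
      by (simp add: power2_eq_square algebra_simps)
    then show ?thesis .
  qed
  finally have sq: "(cmod (1 + m))\<^sup>2 = 1 + 2 * \<rho> * cos \<alpha> + \<rho>\<^sup>2" by simp
  have d: "(dfun (2 * h))\<^sup>2 \<le> (cmod (1 + m))\<^sup>2"
  proof (cases "\<alpha> \<le> pi / 2")
    case True
    then have "0 \<le> cos \<alpha>" using \<alpha> by (intro cos_ge_zero) auto
    then have "1 \<le> (cmod (1 + m))\<^sup>2" using \<rho> by (simp add: sq)
    moreover have "(dfun (2 * h))\<^sup>2 \<le> 1"
      using dfun_pos[of "2 * h"] h by (intro power_le_one) (auto simp: dfun_def)
    ultimately show ?thesis by simp
  next
    case False
    have "sin (2 * h) \<le> sin \<alpha>"
      using False \<alpha> h cos_monotone_0_pi_le[of "\<alpha> - pi / 2" "2 * h - pi / 2"] by (simp add: cos_diff)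
    moreover have "0 \<le> sin (2 * h)" using h by (intro sin_ge_zero) auto
    ultimately have "(sin (2 * h))\<^sup>2 \<le> (sin \<alpha>)\<^sup>2" by (intro power_mono) auto
    \<comment> \<open>For an obtuse angle, sin \<alpha> is the distance from -1 to the ray carrying
      m, attained at \<rho> = - cos \<alpha>.\<close>
    also have "\<dots> \<le> (sin \<alpha>)\<^sup>2 + (cos \<alpha> + \<rho>)\<^sup>2" by simp
    also have "\<dots> = ((sin \<alpha>)\<^sup>2 + (cos \<alpha>)\<^sup>2) + 2 * \<rho> * cos \<alpha> + \<rho>\<^sup>2"
      by (simp add: power2_sum mult_ac)
    also have "\<dots> = (cmod (1 + m))\<^sup>2" by (simp add: sq)
    finally show ?thesis using False \<alpha> by (simp add: dfun_def)
  qed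
  then show dle: "dfun (2 * h) \<le> cmod (1 + m)" by (rule power2_le_imp_le) simp
  with dfun_pos[of "2 * h"] h show nz: "1 + m \<noteq> 0" by auto
  let ?q = "(1 + m) * cis (s * h)"
  have "\<bar>Arg ?q\<bar> \<le> h" using q nz h by (intro Arg_halfcone) auto
  \<comment> \<open>Rotating back causes no jump of the principal argument: the difference has
    modulus at most 2 h < pi.\<close>
  moreover have "Arg (1 + m) = Arg ?q - s * h"
  proof (rule Arg_unique)
    have "?q = of_real (cmod ?q) * cis (Arg ?q)"
      using nz by (simp add: Arg_eq cis_conv_exp)
    then have "1 + m = of_real (cmod ?q) * cis (Arg ?q) * cis (- (s * h))"
      by (metis (no_types, lifting) cis_mult add.right_inverse cis_zero mult.assoc mult.right_neutral)
    then have "1 + m = of_real (cmod (1 + m)) * cis (Arg ?q - s * h)"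
      by (simp add: norm_mult cis_mult mult.assoc)
    then show "of_real (cmod (1 + m)) * exp (\<i> * of_real (Arg ?q - s * h)) = 1 + m"
      unfolding cis_conv_exp by (rule sym)
  qed (use \<open>\<bar>Arg ?q\<bar> \<le> h\<close> s h nz in auto)
  ultimately show "0 \<le> - s * Arg (1 + m)" "- s * Arg (1 + m) \<le> 2 * h" using s by auto
qed

text \<open>For r \<noteq> 0 the determinant is (- r)^n times the characteristic polynomial at - 1 /
  r. One list of eigenvalues therefore serves all r, so the perturbation can later be switched on
  with the list fixed.\<close>

lemma det_one_plus_smult:
  fixes A :: "complex mat"
  assumes A: "A \<in> carrier_mat n n"
  shows "\<exists>ms. length ms = n \<and> (\<forall>m\<in>set ms. eigenvalue A m) \<and>
    (\<forall>r. det (1\<^sub>m n + r \<cdot>\<^sub>m A) = (\<Prod>m\<leftarrow>ms. 1 + r * m))"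
proof -
  obtain ms where ms: "char_poly A = (\<Prod>a\<leftarrow>ms. [:- a, 1:])" "length ms = n"
    using char_poly_factorized[OF A] by auto
  have "eigenvalue A m" if "m \<in> set ms" for m
    using that unfolding eigenvalue_root_char_poly[OF A] ms(1) by (auto simp: poly_prod_list prod_list_zero_iff)
  moreover have "det (1\<^sub>m n + r \<cdot>\<^sub>m A) = (\<Prod>m\<leftarrow>ms. 1 + r * m)" for r
  proof (cases "r = 0")
    case True
    have "1\<^sub>m n + 0 \<cdot>\<^sub>m A = 1\<^sub>m n" using A by (intro eq_matI) auto
    then show ?thesis using True by (simp add: map_replicate_const)
  next
    case False
    have "1\<^sub>m n + r \<cdot>\<^sub>m A = (- r) \<cdot>\<^sub>m (- char_matrix A (- 1 / r))"
      using A False by (intro eq_matI) (auto simp: char_matrix_def field_simps)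
    then have "det (1\<^sub>m n + r \<cdot>\<^sub>m A) = (- r) ^ n * poly (char_poly A) (- 1 / r)"
      using A by (simp add: char_poly_matrix[OF A] char_matrix_def)
    also have "\<dots> = (- r) ^ length ms * (\<Prod>m\<leftarrow>ms. - 1 / r - m)"
    proof -
      have "poly (\<Prod>a\<leftarrow>as. [:- a, 1:]) x = (\<Prod>a\<leftarrow>as. x - a)" for as and x :: complex
        by (induction as) (auto simp: algebra_simps)
      then show ?thesis unfolding ms by simp
    qed
    also have "\<dots> = (\<Prod>m\<leftarrow>ms. 1 + r * m)"
      using False by (induction ms) (auto simp: field_simps)
    finally show ?thesis .
  qed
  ultimately show ?thesis using ms(2) by blast
qed

lemma eigenvalue_unitary_diag_psd:
  fixes P :: "nat \<Rightarrow> nat \<Rightarrow> complex" and \<psi> :: "nat \<Rightarrow> real"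
  assumes h: "0 \<le> h" "2 * h < pi" and s: "s = 1 \<or> s = -1"
    and \<psi>: "\<And>i. i < n \<Longrightarrow> 0 \<le> \<psi> i \<and> \<psi> i \<le> 2 * h"
    and psd: "\<And>v. \<exists>p\<ge>0. (\<Sum>i<n. \<Sum>j<n. cnj (v i) * P i j * v j) = complex_of_real p"
    and ev: "eigenvalue (mat n n (\<lambda>(i, j). cis (- s * \<psi> i / 2) * P i j * cis (- s * \<psi> j / 2))) m"
  shows "m * cis (s * h) \<in> halfcone h"
proof -
  let ?A = "mat n n (\<lambda>(i, j). cis (- s * \<psi> i / 2) * P i j * cis (- s * \<psi> j / 2))"
  obtain v where v: "v \<in> carrier_vec n" "v \<noteq> 0\<^sub>v n" "?A *\<^sub>v v = m \<cdot>\<^sub>v v"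
    using ev by (auto simp: eigenvalue_def eigenvector_def)
  define w where "w = (\<lambda>j. cis (- s * \<psi> j / 2) * v $ j)"
  have row: "(\<Sum>j<n. P i j * w j) = m * cis (s * \<psi> i) * w i" if i: "i < n" for i
  proof -
    have "(\<Sum>j<n. cis (- s * \<psi> i / 2) * P i j * cis (- s * \<psi> j / 2) * v $ j) = m * v $ i"
      using arg_cong[OF v(3), of "\<lambda>x. x $ i"] i v(1) by (simp add: scalar_prod_def atLeast0LessThan)
    then have "cis (- s * \<psi> i / 2) * (\<Sum>j<n. P i j * w j) = m * v $ i"
      by (simp add: w_def sum_distrib_left mult_ac)
    then have "cis (s * \<psi> i / 2) * (cis (- s * \<psi> i / 2) * (\<Sum>j<n. P i j * w j)) = cis (s * \<psi> i / 2) * (m * v $ i)"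
      by simp
    then have "(\<Sum>j<n. P i j * w j) = cis (s * \<psi> i / 2) * m * v $ i"
      by (simp add: mult.assoc[symmetric] cis_mult)
    also have "cis (s * \<psi> i / 2) = cis (s * \<psi> i) * cis (- s * \<psi> i / 2)"
      by (simp add: cis_mult)
    finally show ?thesis by (simp add: w_def mult_ac)
  qed
  \<comment> \<open>The weighted sum of squared inverse phases, turned by - s h so that its sector
    of opening 2 h is centred on the positive axis.\<close>
  define c where "c = (\<Sum>i<n. complex_of_real ((cmod (w i))\<^sup>2) * cis (s * (\<psi> i - h)))"
  have cosh: "0 < cos h" using h by (intro cos_gt_zero_pi) auto
  have c: "c \<in> halfcone h"
    unfolding c_def
  proof (intro halfcone_sum halfcone_scale cis_halfcone)
    fix i assume "i \<in> {..<n}"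
    then show "\<bar>s * (\<psi> i - h)\<bar> \<le> h" using \<psi>[of i] s by (auto simp: abs_mult)
  qed (use cosh h in auto)
  \<comment> \<open>Semidefiniteness allows p = 0, so nonvanishing has to come from the phases: Re c
    is at least cos h times the squared norm of w.\<close>
  have "c \<noteq> 0"
  proof -
    have "\<exists>i<n. v $ i \<noteq> 0" using v(1,2) by (metis carrier_vecD eq_vecI index_zero_vec)
    then obtain i where i: "i < n" "w i \<noteq> 0" by (auto simp: w_def)
    have le: "cos h * (cmod (w i))\<^sup>2 \<le> (cmod (w i))\<^sup>2 * cos (s * (\<psi> i - h))" if "i < n" for i
    proof -
      have "cis (s * (\<psi> i - h)) \<in> halfcone h"
        using \<psi>[OF that] s h by (intro cis_halfcone) (auto simp: abs_mult)
      then have "cos h \<le> cos (s * (\<psi> i - h))" by (simp add: halfcone_def)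
      then show ?thesis unfolding mult.commute[of "cos h"] by (rule mult_left_mono) simp
    qed
    have "0 < cos h * (cmod (w i))\<^sup>2" using i cosh by simp
    also have "\<dots> \<le> (\<Sum>i<n. cos h * (cmod (w i))\<^sup>2)"
      using i cosh by (intro member_le_sum) auto
    also have "\<dots> \<le> (\<Sum>i<n. (cmod (w i))\<^sup>2 * cos (s * (\<psi> i - h)))"
      by (intro sum_mono le) auto
    also have "\<dots> = Re c" by (simp add: c_def)
    finally show ?thesis by auto
  qed
  obtain p where p: "p \<ge> 0" "(\<Sum>i<n. \<Sum>j<n. cnj (w i) * P i j * w j) = complex_of_real p"
    using psd by blast
  have "complex_of_real p = (\<Sum>i<n. cnj (w i) * (\<Sum>j<n. P i j * w j))"
    by (simp add: p(2)[symmetric] sum_distrib_left mult.assoc)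
  also have "\<dots> = (\<Sum>i<n. m * cis (s * h) * (complex_of_real ((cmod (w i))\<^sup>2) * cis (s * (\<psi> i - h))))"
  proof (intro sum.cong refl)
    fix i assume "i \<in> {..<n}"
    then have "cnj (w i) * (\<Sum>j<n. P i j * w j) = m * cis (s * \<psi> i) * (w i * cnj (w i))"
      by (simp add: row)
    also have "cis (s * \<psi> i) = cis (s * h) * cis (s * (\<psi> i - h))"
      by (simp add: cis_mult algebra_simps)
    finally show "cnj (w i) * (\<Sum>j<n. P i j * w j) = m * cis (s * h) * (complex_of_real ((cmod (w i))\<^sup>2) * cis (s * (\<psi> i - h)))"
      by (simp add: complex_norm_square mult_ac del: of_real_power)
  qed
  also have "\<dots> = m * cis (s * h) * c" by (simp add: c_def sum_distrib_left)
  finally have "m * cis (s * h) = complex_of_real p / c" using \<open>c \<noteq> 0\<close> by (simp add: field_simps)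
  then show ?thesis using halfcone_divide[OF c p(1)] by simp
qed

text \<open>Positivity of the Cauchy form comes from
  \<open>\<i> / (w\<^sub>j - cnj w\<^sub>i) = \<integral>\<^sub>0\<^sup>\<infinity> exp (\<i> (w\<^sub>j - cnj w\<^sub>i) s) ds\<close>.\<close>

lemma cauchy_form_nonneg:
  fixes w v :: "nat \<Rightarrow> complex"
  assumes "\<And>i. i < n \<Longrightarrow> 0 < Im (w i)"
  shows "\<exists>p\<ge>0. (\<Sum>i<n. \<Sum>j<n. cnj (v i) * (\<i> / (w j - cnj (w i))) * v j) = complex_of_real p"
proof -
  define Q where "Q = (\<lambda>i j. w j - cnj (w i))"
  have Q: "0 < Im (Q i j)" if "i < n" "j < n" for i j
    using assms[OF that(1)] assms[OF that(2)] by (simp add: Q_def)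
  \<comment> \<open>The form with the integral cut off at T, in closed form. It is the integral over
    [0, T] of the squared modulus of the sum of v_j exp (i w_j s), and Im Q > 0 makes the boundary
    terms vanish as T grows.\<close>
  define I where "I = (\<lambda>T. \<Sum>i<n. \<Sum>j<n. cnj (v i) * (\<i> / Q i j * (1 - exp (\<i> * Q i j * of_real T))) * v j)"
  have I: "\<exists>p\<ge>0. I T = complex_of_real p" if "0 \<le> T" for T
  proof -
    have one: "((\<lambda>s. exp (\<i> * Q i j * of_real s)) has_integral (\<i> / Q i j * (1 - exp (\<i> * Q i j * of_real T)))) {0..T}"
      if "i < n" "j < n" for i j
    proof -
      have Q0: "Q i j \<noteq> 0" using Q[OF that] by auto
      have "((\<lambda>s. exp (\<i> * Q i j * of_real s) / (\<i> * Q i j)) has_vector_derivative exp (\<i> * Q i j * of_real s)) (at s within {0..T})" for s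
        using Q0 by (auto intro!: derivative_eq_intros has_vector_derivative_real_field simp: field_simps)
      then have "((\<lambda>s. exp (\<i> * Q i j * of_real s)) has_integral
         exp (\<i> * Q i j * of_real T) / (\<i> * Q i j) - exp (\<i> * Q i j * of_real 0) / (\<i> * Q i j)) {0..T}"
        using \<open>0 \<le> T\<close> by (intro fundamental_theorem_of_calculus)
      also have "exp (\<i> * Q i j * of_real T) / (\<i> * Q i j) - exp (\<i> * Q i j * of_real 0) / (\<i> * Q i j)
         = \<i> / Q i j * (1 - exp (\<i> * Q i j * of_real T))"
        using Q0 by (simp add: field_simps)
      finally show ?thesis .
    qed
    have "((\<lambda>s. \<Sum>i<n. \<Sum>j<n. cnj (v i) * exp (\<i> * Q i j * of_real s) * v j) has_integral I T) {0..T}"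
      unfolding I_def by (intro has_integral_sum has_integral_mult_left has_integral_mult_right one) auto
    also have "(\<lambda>s. \<Sum>i<n. \<Sum>j<n. cnj (v i) * exp (\<i> * Q i j * of_real s) * v j)
       = (\<lambda>s. complex_of_real ((cmod (\<Sum>j<n. v j * exp (\<i> * w j * of_real s)))\<^sup>2))"
    proof
      fix s :: real
      have "complex_of_real ((cmod (\<Sum>j<n. v j * exp (\<i> * w j * of_real s)))\<^sup>2)
        = cnj (\<Sum>j<n. v j * exp (\<i> * w j * of_real s)) * (\<Sum>j<n. v j * exp (\<i> * w j * of_real s))"
        by (simp only: complex_norm_square mult.commute)
      also have "\<dots> = (\<Sum>i<n. cnj (v i) * exp (- \<i> * cnj (w i) * of_real s)) * (\<Sum>j<n. v j * exp (\<i> * w j * of_real s))"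
        by (simp add: exp_cnj)
      also have "\<dots> = (\<Sum>i<n. \<Sum>j<n. cnj (v i) * exp (\<i> * Q i j * of_real s) * v j)"
        unfolding sum_product by (intro sum.cong refl) (simp add: Q_def algebra_simps exp_diff exp_minus field_simps)
      finally show "(\<Sum>i<n. \<Sum>j<n. cnj (v i) * exp (\<i> * Q i j * of_real s) * v j)
       = complex_of_real ((cmod (\<Sum>j<n. v j * exp (\<i> * w j * of_real s)))\<^sup>2)" ..
    qed
    finally have hi: "((\<lambda>s. complex_of_real ((cmod (\<Sum>j<n. v j * exp (\<i> * w j * of_real s)))\<^sup>2)) has_integral I T) {0..T}" .
    have "((\<lambda>s. (cmod (\<Sum>j<n. v j * exp (\<i> * w j * of_real s)))\<^sup>2) has_integral Re (I T)) {0..T}"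
      using has_integral_Re[OF hi] by simp
    then have "0 \<le> Re (I T)" by (rule has_integral_nonneg) simp
    moreover have "((\<lambda>s. 0::real) has_integral Im (I T)) {0..T}"
      using has_integral_Im[OF hi] by simp
    then have "Im (I T) = 0" by (metis has_integral_0 has_integral_unique)
    ultimately show ?thesis by (intro exI[of _ "Re (I T)"]) (simp add: complex_eq_iff)
  qed
  have "(I \<longlongrightarrow> (\<Sum>i<n. \<Sum>j<n. cnj (v i) * (\<i> / Q i j * (1 - 0)) * v j)) at_top"
    unfolding I_def
  proof (intro tendsto_sum tendsto_mult tendsto_diff tendsto_const)
    fix i j assume "i \<in> {..<n}" "j \<in> {..<n}"
    then have q: "0 < Im (Q i j)" using Q by auto
    have "((\<lambda>T. exp (- (Im (Q i j) * T))) \<longlongrightarrow> 0) at_top"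
      by (rule filterlim_compose[OF exp_at_bot])
         (use q in \<open>auto simp: filterlim_uminus_at_bot intro!: filterlim_tendsto_pos_mult_at_top[OF tendsto_const] filterlim_ident\<close>)
    then show "((\<lambda>T. exp (\<i> * Q i j * of_real T)) \<longlongrightarrow> 0) at_top"
      by (subst tendsto_norm_zero_iff[symmetric]) simp
  qed
  then have lim: "(I \<longlongrightarrow> (\<Sum>i<n. \<Sum>j<n. cnj (v i) * (\<i> / Q i j) * v j)) at_top" (is "(I \<longlongrightarrow> ?L) _") by simp
  have ev: "eventually (\<lambda>T. 0 \<le> Re (I T) \<and> Im (I T) = 0) at_top"
    using eventually_ge_at_top[of 0] by eventually_elim (use I in force)
  have "0 \<le> Re ?L"
    by (rule tendsto_lowerbound[OF tendsto_Re[OF lim]]) (use ev in \<open>auto elim: eventually_mono\<close>)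
  moreover have "Im ?L = 0"
    using tendsto_unique[OF _ tendsto_Im[OF lim], of 0] ev
    by (metis (mono_tags, lifting) eventually_mono tendsto_eventually trivial_limit_at_top_linorder)
  ultimately have "?L = complex_of_real (Re ?L)" by (simp add: complex_eq_iff del: Re_sum Im_sum)
  then show ?thesis using \<open>0 \<le> Re ?L\<close> unfolding Q_def by blast
qed

section \<open>The continuous argument on the strip\<close>

definition tauM :: "nat \<Rightarrow> (nat \<Rightarrow> real) \<Rightarrow> (nat \<Rightarrow> real) \<Rightarrow> (nat \<Rightarrow> complex) \<Rightarrow> complex \<Rightarrow> complex mat" where
  "tauM n d k w z = mat n n (\<lambda>(i, j).
     of_real (d i) * exp (- of_real (k i) * z) * (\<i> / (w j - cnj (w i))) * (of_real (d j) * exp (- of_real (k j) * z)))"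

lemma tauM_carrier [simp]: "tauM n d k w z \<in> carrier_mat n n"
  by (simp add: tauM_def)

text \<open>The values of f are multiples of 2 pi, hence at least 2 pi apart when distinct.\<close>

lemma connected_cis_1_imp_eq:
  fixes f :: "'a::topological_space \<Rightarrow> real"
  assumes "connected S" "continuous_on S f" "\<And>x. x \<in> S \<Longrightarrow> cis (f x) = 1" "x \<in> S" "y \<in> S"
  shows "f x = f y"
proof -
  have "f constant_on S"
  proof (rule continuous_discrete_range_constant[OF assms(1,2)])
    fix x assume x: "x \<in> S"
    have "2 * pi \<le> norm (f y - f x)" if y: "y \<in> S" "f y \<noteq> f x" for y
    proof -
      have "cis (f y - f x) = 1" using assms(3)[OF x] assms(3)[OF y(1)] by (simp add: cis_divide[symmetric])
      then have "cos (f y - f x) = 1" by (metis cis.sel(1) one_complex.sel(1))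
      then obtain m :: int where m: "f y - f x = m * (2 * pi)"
        unfolding cos_one_2pi_int by (auto simp: mult_ac)
      with y(2) have "m \<noteq> 0" by auto
      then have "1 \<le> \<bar>real_of_int m\<bar>" by linarith
      then show ?thesis using mult_right_mono[of 1 "\<bar>real_of_int m\<bar>" "2 * pi"]
        by (simp add: m abs_mult)
    qed
    then show "\<exists>e>0. \<forall>y. y \<in> S \<and> f y \<noteq> f x \<longrightarrow> e \<le> norm (f y - f x)"
      by (intro exI[of _ "2 * pi"]) auto
  qed
  then show ?thesis using assms(4,5) by (auto simp: constant_on_def)
qed

lemma eq_exp_imp_polar: "z = exp l \<Longrightarrow> z = of_real (cmod z) * cis (Im l)"
  by (metis exp_eq_polar norm_exp_eq_Re)

lemma tau_factor:
  fixes n :: nat and d k :: "nat \<Rightarrow> real" and w :: "nat \<Rightarrow> complex"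
  assumes w: "\<And>i. i < n \<Longrightarrow> 0 < Im (w i)"
    and k: "\<And>i. i < n \<Longrightarrow> 0 \<le> k i \<and> k i \<le> K"
    and K: "0 \<le> K" "2 * K * \<bar>Im z\<bar> < pi"
  defines "s \<equiv> if 0 \<le> Im z then 1 else - 1 :: real" and "h \<equiv> K * \<bar>Im z\<bar>"
  obtains ms where "length ms = n" "\<And>m. m \<in> set ms \<Longrightarrow> m * cis (s * h) \<in> halfcone h"
    "\<And>r. det (1\<^sub>m n + r \<cdot>\<^sub>m tauM n d k w z) = (\<Prod>m\<leftarrow>ms. 1 + r * m)"
proof -
  \<comment> \<open>The modulus of exp (- k z) is absorbed into the semidefinite P through c. The
    phase acts from both sides, hence the factor 2 in \<psi>.\<close>
  define \<psi> where "\<psi> = (\<lambda>i. 2 * (k i * \<bar>Im z\<bar>))"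
  define c where "c = (\<lambda>i. d i * exp (- k i * Re z))"
  define P where "P = (\<lambda>i j. of_real (c i) * (\<i> / (w j - cnj (w i))) * of_real (c j))"
  have D: "of_real (d i) * exp (- of_real (k i) * z) = of_real (c i) * cis (- s * \<psi> i / 2)" for i
  proof -
    have "exp (- of_real (k i) * z) = of_real (exp (- k i * Re z)) * cis (- k i * Im z)"
      by (subst exp_eq_polar) simp
    moreover have "s * \<bar>Im z\<bar> = Im z" by (simp add: s_def)
    then have "- s * \<psi> i / 2 = - k i * Im z" by (simp add: \<psi>_def algebra_simps)
    ultimately show ?thesis by (simp add: c_def)
  qed
  have tau: "tauM n d k w z = mat n n (\<lambda>(i, j). cis (- s * \<psi> i / 2) * P i j * cis (- s * \<psi> j / 2))"
    unfolding tauM_def D by (intro eq_matI) (auto simp: P_def mult_ac)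
  have psd: "\<exists>p\<ge>0. (\<Sum>i<n. \<Sum>j<n. cnj (v i) * P i j * v j) = complex_of_real p" for v :: "nat \<Rightarrow> complex"
    using cauchy_form_nonneg[OF w, where v = "\<lambda>i. of_real (c i) * v i"] by (simp add: P_def mult_ac)
  obtain ms where ms: "length ms = n" "\<And>m. m \<in> set ms \<Longrightarrow> eigenvalue (tauM n d k w z) m"
    "\<And>r. det (1\<^sub>m n + r \<cdot>\<^sub>m tauM n d k w z) = (\<Prod>m\<leftarrow>ms. 1 + r * m)"
    using det_one_plus_smult[OF tauM_carrier] by metis
  have "m * cis (s * h) \<in> halfcone h" if "m \<in> set ms" for m
  proof (rule eigenvalue_unitary_diag_psd)
    show "eigenvalue (mat n n (\<lambda>(i, j). cis (- s * \<psi> i / 2) * P i j * cis (- s * \<psi> j / 2))) m"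
      using ms(2)[OF that] by (simp add: tau)
  qed (use psd K k in \<open>auto simp: h_def s_def \<psi>_def intro: mult_right_mono\<close>)
  with ms that show thesis by blast
qed

text \<open>The Leibniz formula yields continuity jointly in r and z; eigenvalue lists chosen
  separately for each z would not.\<close>

lemma det_tau_continuous:
  fixes n :: nat
  shows "continuous_on UNIV (\<lambda>(r, z). det (1\<^sub>m n + complex_of_real r \<cdot>\<^sub>m tauM n d k w z))"
proof -
  have eq: "det (1\<^sub>m n + complex_of_real r \<cdot>\<^sub>m tauM n d k w z) =
    (\<Sum>p\<in>{p. p permutes {0..<n}}. signof p * (\<Prod>i = 0..<n. (if i = p i then 1 else 0) + of_real r *
       (of_real (d i) * exp (- of_real (k i) * z) * (\<i> / (w (p i) - cnj (w i))) * (of_real (d (p i)) * exp (- of_real (k (p i)) * z)))))"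
    for r z
  proof -
    have c: "1\<^sub>m n + complex_of_real r \<cdot>\<^sub>m tauM n d k w z \<in> carrier_mat n n" by simp
    show ?thesis unfolding det_def'[OF c]
      by (intro sum.cong prod.cong arg_cong2[where f = "(*)"] refl)
         (auto simp: tauM_def dest: permutes_in_image)
  qed
  show ?thesis unfolding eq case_prod_unfold by (intro continuous_intros)
qed

text \<open>The argument of the determinant is not determined by its factors \<open>1 + m\<close> pointwise.
  Scaling the perturbation by \<open>r \<in> [0, 1]\<close> at fixed \<open>z\<close> keeps the eigenvalues fixed, so the sum
  of principal arguments is continuous in \<open>r\<close> and vanishes at \<open>r = 0\<close>; it therefore agrees
  with a logarithm taken on the simply connected product of \<open>[0, 1]\<close> and the strip.\<close>

lemma tau_strip:
  fixes n :: nat and d k :: "nat \<Rightarrow> real" and w :: "nat \<Rightarrow> complex"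
  assumes w: "\<And>i. i < n \<Longrightarrow> 0 < Im (w i)"
    and k: "\<And>i. i < n \<Longrightarrow> 0 \<le> k i \<and> k i \<le> K"
    and K: "0 \<le> K" "0 \<le> Y" "2 * K * Y < pi"
  defines "S \<equiv> {z. \<bar>Im z\<bar> \<le> Y}" and "Z \<equiv> \<lambda>z. det (1\<^sub>m n + tauM n d k w z)"
  obtains \<Phi> where "continuous_on S \<Phi>"
    "\<And>z. z \<in> S \<Longrightarrow> Z z = of_real (cmod (Z z)) * cis (\<Phi> z)"
    "\<And>z. z \<in> S \<Longrightarrow> dfun (2 * K * \<bar>Im z\<bar>) ^ n \<le> cmod (Z z)"
    "\<And>z. z \<in> S \<Longrightarrow> 0 \<le> - (if 0 \<le> Im z then 1 else - 1) * \<Phi> z"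
    "\<And>z. z \<in> S \<Longrightarrow> - (if 0 \<le> Im z then 1 else - 1) * \<Phi> z \<le> n * (2 * K * \<bar>Im z\<bar>)"
proof -
  define F where "F = (\<lambda>(r, z). det (1\<^sub>m n + complex_of_real r \<cdot>\<^sub>m tauM n d k w z))"
  define T where "T = {0..1::real} \<times> S"
  define s where "s = (\<lambda>z. if 0 \<le> Im z then 1 else - 1 :: real)"
  define h where "h = (\<lambda>z. K * \<bar>Im z\<bar>)"
  have FZ: "F (1, z) = Z z" for z
  proof -
    have "complex_of_real 1 \<cdot>\<^sub>m tauM n d k w z = tauM n d k w z" by (intro eq_matI) auto
    then show ?thesis by (simp add: F_def Z_def)
  qed
  have h: "0 \<le> h z" "2 * h z < pi" if "z \<in> S" for z
  proof -
    have "2 * (K * \<bar>Im z\<bar>) \<le> 2 * (K * Y)" using that K by (intro mult_left_mono) (auto simp: S_def)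
    then show "0 \<le> h z" "2 * h z < pi" using K by (auto simp: h_def)
  qed
  have "\<forall>z\<in>S. \<exists>ms. length ms = n \<and> (\<forall>m\<in>set ms. m * cis (s z * h z) \<in> halfcone (h z)) \<and>
    (\<forall>r. F (r, z) = (\<Prod>m\<leftarrow>ms. 1 + of_real r * m))"
  proof
    fix z assume z: "z \<in> S"
    have a: "2 * K * \<bar>Im z\<bar> < pi" using h(2)[OF z] by (simp add: h_def)
    show "\<exists>ms. length ms = n \<and> (\<forall>m\<in>set ms. m * cis (s z * h z) \<in> halfcone (h z)) \<and>
      (\<forall>r. F (r, z) = (\<Prod>m\<leftarrow>ms. 1 + of_real r * m))"
      by (rule tau_factor[of n w k K z d, OF w k K(1) a]) (auto simp: F_def s_def h_def)
  qed
  then obtain ms where len: "\<And>z. z \<in> S \<Longrightarrow> length (ms z) = n"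
    and ms: "\<And>z m. z \<in> S \<Longrightarrow> m \<in> set (ms z) \<Longrightarrow> m * cis (s z * h z) \<in> halfcone (h z)"
    and F: "\<And>z r. z \<in> S \<Longrightarrow> F (r, z) = (\<Prod>m\<leftarrow>ms z. 1 + of_real r * m)"
    by metis
  have sgn: "s z = 1 \<or> s z = -1" for z by (simp add: s_def)
  have rm: "of_real r * m * cis (s z * h z) \<in> halfcone (h z)" if "z \<in> S" "m \<in> set (ms z)" "0 \<le> r" for z m r
    using halfcone_scale[OF that(3) ms[OF that(1,2)]] by (simp add: mult.assoc)
  note sector = one_plus_sector[OF h sgn rm]
  define \<psi> where "\<psi> = (\<lambda>r z. \<Sum>m\<leftarrow>ms z. Arg (1 + complex_of_real r * m))"
  have F_psi: "F (r, z) = of_real (cmod (F (r, z))) * cis (\<psi> r z)" "F (r, z) \<noteq> 0"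
    if z: "z \<in> S" and r: "0 \<le> r" for r z
  proof -
    have "prod_list xs = of_real (cmod (prod_list xs)) * cis (sum_list (map Arg xs)) \<and> prod_list xs \<noteq> 0"
      if "\<And>x. x \<in> set xs \<Longrightarrow> x \<noteq> 0" for xs :: "complex list"
      using that
    proof (induction xs)
      case (Cons x xs)
      then have IH: "prod_list xs = of_real (cmod (prod_list xs)) * cis (sum_list (map Arg xs))" and "prod_list xs \<noteq> 0" "x \<noteq> 0"
        by auto
      have "x = of_real (cmod x) * cis (Arg x)" using \<open>x \<noteq> 0\<close> by (simp add: Arg_eq cis_conv_exp)
      then have "x * prod_list xs = (of_real (cmod x) * cis (Arg x)) * (of_real (cmod (prod_list xs)) * cis (sum_list (map Arg xs)))"
        using IH by simp
      also have "\<dots> = of_real (cmod (x * prod_list xs)) * cis (Arg x + sum_list (map Arg xs))"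
        by (simp add: norm_mult cis_mult[symmetric] mult_ac)
      finally show ?case using \<open>prod_list xs \<noteq> 0\<close> \<open>x \<noteq> 0\<close> by simp
    qed simp
    moreover have "x \<noteq> 0" if "x \<in> set (map (\<lambda>m. 1 + complex_of_real r * m) (ms z))" for x
      using sector(1)[OF z z z _ r] that by auto
    ultimately have "prod_list (map (\<lambda>m. 1 + complex_of_real r * m) (ms z)) =
        of_real (cmod (prod_list (map (\<lambda>m. 1 + complex_of_real r * m) (ms z)))) *
        cis (sum_list (map Arg (map (\<lambda>m. 1 + complex_of_real r * m) (ms z))))
      \<and> prod_list (map (\<lambda>m. 1 + complex_of_real r * m) (ms z)) \<noteq> 0"
      by blast
    then show "F (r, z) = of_real (cmod (F (r, z))) * cis (\<psi> r z)" "F (r, z) \<noteq> 0"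
      unfolding F[OF z] \<psi>_def map_map o_def by blast+
  qed
  have "S = {z. Im z \<le> Y} \<inter> {z. Im z \<ge> - Y}" by (auto simp: S_def)
  then have "convex S" by (simp add: convex_Int convex_halfspace_Im_le convex_halfspace_Im_ge)
  then have "connected S" and "convex T"
    by (auto simp: T_def intro: convex_connected convex_Times)
  have "continuous_on T F"
    unfolding F_def by (rule continuous_on_subset[OF det_tau_continuous]) simp
  then obtain L where L: "continuous_on T L" "\<And>x. x \<in> T \<Longrightarrow> F x = exp (L x)"
    by (rule continuous_logarithm_on_contractible[OF _ convex_imp_contractible[OF \<open>convex T\<close>]])
       (use F_psi(2) in \<open>auto simp: T_def\<close>)
  have S0: "0 \<in> S" using K by (simp add: S_def)
  define \<Phi> where "\<Phi> = (\<lambda>z. Im (L (1, z)) - Im (L (0, 0)))"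
  \<comment> \<open>At r = 0 the determinant is 1, so the imaginary part of the logarithm is one and
    the same multiple of 2 pi on the connected strip. Subtracting it normalises \<Phi>.\<close>
  have L0: "Im (L (0, z)) = Im (L (0, 0))" if "z \<in> S" for z
  proof (rule connected_cis_1_imp_eq[OF \<open>connected S\<close> _ _ that S0])
    show "continuous_on S (\<lambda>z. Im (L (0, z)))"
      by (intro continuous_intros continuous_on_compose2[OF L(1)]) (auto simp: T_def)
    fix z assume z: "z \<in> S"
    have "exp (L (0, z)) = 1" using L(2)[of "(0, z)"] F[OF z, of 0] z by (simp add: T_def map_replicate_const)
    then show "cis (Im (L (0, z))) = 1" using eq_exp_imp_polar[of 1 "L (0, z)"] by simp
  qed
  have Phi: "\<Phi> z = \<psi> 1 z" if z: "z \<in> S" for z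
  proof -
    have c: "continuous_on {0..1} (\<lambda>r. Im (L (r, z)) - \<psi> r z)"
      unfolding \<psi>_def
    proof (intro continuous_on_diff)
      show "continuous_on {0..1} (\<lambda>r. Im (L (r, z)))"
        by (intro continuous_intros continuous_on_compose2[OF L(1)]) (use z in \<open>auto simp: T_def\<close>)
      have "continuous_on {0..1} (\<lambda>r. \<Sum>m\<leftarrow>xs. Arg (1 + complex_of_real r * m))" if "set xs \<subseteq> set (ms z)" for xs
        using that
      proof (induction xs)
        case (Cons m xs)
        \<comment> \<open>A nonzero number on the branch cut would have argument pi, but the sector
          allows at most 2 h < pi.\<close>
        have "1 + complex_of_real r * m \<notin> \<real>\<^sub>\<le>\<^sub>0" if r: "r \<in> {0..1}" for r
        proof
          assume neg: "1 + complex_of_real r * m \<in> \<real>\<^sub>\<le>\<^sub>0"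
          have nz: "1 + complex_of_real r * m \<noteq> 0" using sector(1)[OF z z z, of m r] Cons.prems r by auto
          with neg have "Arg (1 + complex_of_real r * m) = pi"
            by (auto simp: Arg_eq_pi_iff complex_nonpos_Reals_iff complex_is_Real_iff complex_eq_iff)
          then show False
            using sector(3,4)[OF z z z, of m r] Cons.prems r h[OF z] by (auto simp: s_def split: if_splits)
        qed
        then have "continuous_on {0..1} (\<lambda>r. Arg (1 + complex_of_real r * m))"
          by (intro continuous_on_compose2[OF continuous_on_Arg, where f = "\<lambda>r. 1 + complex_of_real r * m"] continuous_intros) auto
        with Cons show ?case by (auto intro: continuous_on_add)
      qed simp
      then show "continuous_on {0..1} (\<lambda>r. \<Sum>m\<leftarrow>ms z. Arg (1 + complex_of_real r * m))" by blast
    qed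
    have one: "cis (Im (L (r, z)) - \<psi> r z) = 1" if r: "r \<in> {0..1}" for r
    proof -
      have "F (r, z) = of_real (cmod (F (r, z))) * cis (Im (L (r, z)))"
        using L(2)[of "(r, z)"] r z by (intro eq_exp_imp_polar) (auto simp: T_def)
      moreover have "F (r, z) = of_real (cmod (F (r, z))) * cis (\<psi> r z)" "F (r, z) \<noteq> 0"
        using F_psi[OF z] r by auto
      ultimately have "cis (Im (L (r, z))) = cis (\<psi> r z)"
        by (metis mult_cancel_left norm_eq_zero of_real_eq_0_iff)
      then show ?thesis by (simp add: cis_divide[symmetric])
    qed
    have "Im (L (1, z)) - \<psi> 1 z = Im (L (0, z)) - \<psi> 0 z"
      by (rule connected_cis_1_imp_eq[OF _ c one]) auto
    moreover have "\<psi> 0 z = 0" by (simp add: \<psi>_def)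
    ultimately show ?thesis using L0[OF z] by (simp add: \<Phi>_def)
  qed
  show thesis
  proof (rule that)
    show "continuous_on S \<Phi>"
      unfolding \<Phi>_def
      by (intro continuous_intros continuous_on_compose2[OF L(1)]) (auto simp: T_def)
    fix z assume z: "z \<in> S"
    show "Z z = of_real (cmod (Z z)) * cis (\<Phi> z)"
      using F_psi(1)[OF z, of 1] by (simp add: Phi[OF z] FZ)
    have d0: "0 \<le> dfun (2 * h z)" using dfun_pos[of "2 * h z"] h[OF z] by simp
    have "dfun (2 * h z) ^ length xs \<le> cmod (\<Prod>m\<leftarrow>xs. 1 + m)" if "set xs \<subseteq> set (ms z)" for xs
      using that
    proof (induction xs)
      case (Cons m xs)
      then show ?case using sector(2)[OF z z z, of m 1] d0
        by (auto simp: norm_mult intro!: mult_mono)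
    qed simp
    from this[of "ms z"] show "dfun (2 * K * \<bar>Im z\<bar>) ^ n \<le> cmod (Z z)"
      using F[OF z, of 1] len[OF z] by (simp add: FZ h_def mult.assoc)
    have "0 \<le> - s z * (\<Sum>m\<leftarrow>xs. Arg (1 + m)) \<and> - s z * (\<Sum>m\<leftarrow>xs. Arg (1 + m)) \<le> length xs * (2 * h z)"
      if "set xs \<subseteq> set (ms z)" for xs
      using that
    proof (induction xs)
      case (Cons m xs)
      then show ?case using sector(3,4)[OF z z z, of m 1]
        by (auto simp: algebra_simps)
    qed simp
    from this[of "ms z"] show "0 \<le> - (if 0 \<le> Im z then 1 else - 1) * \<Phi> z"
      "- (if 0 \<le> Im z then 1 else - 1) * \<Phi> z \<le> n * (2 * K * \<bar>Im z\<bar>)"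
      using Phi[OF z] len[OF z] by (simp_all add: \<psi>_def s_def h_def mult.assoc)
  qed
qed

section \<open>The tau function\<close>

text \<open>Im z enters the diagonal only as a phase, so each weight in the subset expansion has the
  modulus it has at Re z.\<close>

lemma cmod_Dent_power2:
  assumes "epsN \<delta> u0 N \<noteq> 0"
  shows "(cmod (Dent \<delta> u0 N n z t))\<^sup>2 = exp (- (2 / epsN \<delta> u0 N) * VV \<delta> u0 (kap \<delta> u0 N n) (Re z) t)"
proof -
  let ?e = "epsN \<delta> u0 N" and ?k = "kap \<delta> u0 N n"
  let ?I = "Im ((zn \<delta> u0 N n - complex_of_real (1 / (2 * \<delta>)))\<^sup>2)"
  have "(cmod (Dent \<delta> u0 N n z t))\<^sup>2 = cn \<delta> u0 N n * (exp (- ?k * Re z / ?e - ?I * t / ?e))\<^sup>2"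
    unfolding Dent_def by (simp add: norm_mult power_mult_distrib cn_def del: power2_eq_square)
  also have "\<dots> = exp (2 * thetap \<delta> u0 ?k / ?e + 2 * (- ?k * Re z / ?e - ?I * t / ?e))"
    by (simp only: cn_def exp_add exp_double)
  also have "2 * thetap \<delta> u0 ?k / ?e + 2 * (- ?k * Re z / ?e - ?I * t / ?e) = - (2 / ?e) * VV \<delta> u0 ?k (Re z) t"
    using assms by (simp add: VV_def zn_def field_simps)
  finally show ?thesis .
qed

lemma exp_minus_gg:
  assumes "\<zeta> \<noteq> \<mu>" "0 < Im \<zeta>" "0 < Im \<mu>"
  shows "exp (- gg \<zeta> \<mu>) = cmod ((\<zeta> - \<mu>) / (\<zeta> - cnj \<mu>))"
proof -
  have "\<zeta> - cnj \<mu> \<noteq> 0"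
  proof
    assume "\<zeta> - cnj \<mu> = 0"
    then have "Im (\<zeta> - cnj \<mu>) = 0" by simp
    with assms show False by simp
  qed
  then have "0 < cmod ((\<zeta> - cnj \<mu>) / (\<zeta> - \<mu>))" using assms by simp
  then show ?thesis using assms(1) by (simp add: gg_def exp_minus norm_divide)
qed

text \<open>The diagonal convention for g reproduces the diagonal entry of the Cauchy
  matrix.\<close>

lemma exp_minus_gg_self:
  assumes "0 < Im \<zeta>"
  shows "exp (- gg \<zeta> \<zeta>) = 1 / (2 * Im \<zeta>)"
proof -
  have "cmod (\<zeta> - cnj \<zeta>) = 2 * Im \<zeta>" using assms by (simp add: complex_diff_cnj norm_mult)
  then show ?thesis using assms by (simp add: gg_def exp_minus inverse_eq_divide)
qed

context
  fixes \<delta> :: real and u0 :: "real \<Rightarrow> real" and N :: nat and t :: real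
  assumes \<delta>: "0 < \<delta>" and u: "admissible u0" and sq: "(\<lambda>x. sqrt (u0 x)) integrable_on UNIV"
    and N: "1 \<le> N"
begin

lemma ZN_upper_bound:
  "cmod (ZN \<delta> u0 N z t) \<le> 2 ^ N * exp (- 2 / (pi * (epsN \<delta> u0 N)\<^sup>2) * Emin \<delta> u0 N (Re z) t)"
proof -
  note k = kap[OF \<delta> u sq, of _ N] and Im = Im_zn[OF \<delta> u sq, of _ N]
  have eps: "0 < epsN \<delta> u0 N" using epsN_pos[OF \<delta> u sq N] .
  let ?e = "epsN \<delta> u0 N"
  let ?D = "\<lambda>i. Dent \<delta> u0 N (Suc i) z t" and ?w = "\<lambda>i. zn \<delta> u0 N (Suc i)"
  have Impos: "0 < Im (zn \<delta> u0 N n)" if "n \<in> {1..N}" for n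
    using k(1)[OF that] Im[OF that] by simp
  have zn_inj: "inj_on (zn \<delta> u0 N) {1..N}"
  proof (rule inj_onI)
    fix n m assume nm: "n \<in> {1..N}" "m \<in> {1..N}" "zn \<delta> u0 N n = zn \<delta> u0 N m"
    then have "kap \<delta> u0 N n = kap \<delta> u0 N m" using Im[OF nm(1)] Im[OF nm(2)] by simp
    from inj_onD[OF inj_on_kap[OF \<delta> u sq] this nm(1,2)] show "n = m" .
  qed
  have expansion: "ZN \<delta> u0 N z t = (\<Sum>S\<in>Pow {..<N}. (\<Prod>i\<in>S. ?D i * ?D i / (2 * Im (?w i))) *
       (\<Prod>i\<in>S. \<Prod>j\<in>S - {i}. complex_of_real (cmod ((?w i - ?w j) / (?w i - cnj (?w j))))))"
    unfolding ZN_def Cent_def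
  proof (rule det_one_plus_cauchy)
    show "inj_on ?w {..<N}"
    proof (rule inj_onI)
      fix i j assume ij: "i \<in> {..<N}" "j \<in> {..<N}" "?w i = ?w j"
      then have "Suc i \<in> {1..N}" "Suc j \<in> {1..N}" by auto
      from inj_onD[OF zn_inj ij(3) this] show "i = j" by simp
    qed
  qed (use Impos in \<open>auto simp: Dent_def cn_def\<close>)
  have "cmod (ZN \<delta> u0 N z t) \<le> (\<Sum>S\<in>Pow {..<N}. exp (- 2 / (pi * ?e\<^sup>2) * Emin \<delta> u0 N (Re z) t))"
    unfolding expansion
  proof (rule order_trans[OF norm_sum sum_mono])
    fix S assume "S \<in> Pow {..<N}"
    then have S: "S \<subseteq> {..<N}" and fin: "finite S" by (auto intro: finite_subset)
    have SN: "Suc i \<in> {1..N}" if "i \<in> S" for i using S that by auto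
    have g: "exp (- (\<Sum>j\<in>S. gg (?w i) (?w j))) = 1 / (2 * Im (?w i)) * (\<Prod>j\<in>S - {i}. cmod ((?w i - ?w j) / (?w i - cnj (?w j))))"
      if i: "i \<in> S" for i
    proof -
      have "exp (- (\<Sum>j\<in>S. gg (?w i) (?w j))) = (\<Prod>j\<in>S. exp (- gg (?w i) (?w j)))"
        using fin by (simp add: exp_sum sum_negf[symmetric])
      also have "\<dots> = exp (- gg (?w i) (?w i)) * (\<Prod>j\<in>S - {i}. exp (- gg (?w i) (?w j)))"
        using fin i by (rule prod.remove)
      also have "exp (- gg (?w i) (?w i)) = 1 / (2 * Im (?w i))"
        by (rule exp_minus_gg_self[OF Impos[OF SN[OF i]]])
      also have "(\<Prod>j\<in>S - {i}. exp (- gg (?w i) (?w j))) = (\<Prod>j\<in>S - {i}. cmod ((?w i - ?w j) / (?w i - cnj (?w j))))"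
      proof (rule prod.cong[OF refl])
        fix j assume j: "j \<in> S - {i}"
        have "?w i \<noteq> ?w j" using inj_onD[OF zn_inj, of "Suc i" "Suc j"] SN i j by auto
        then show "exp (- gg (?w i) (?w j)) = cmod ((?w i - ?w j) / (?w i - cnj (?w j)))"
          using i j by (intro exp_minus_gg Impos SN) auto
      qed
      finally show ?thesis .
    qed
    have "cmod ((\<Prod>i\<in>S. ?D i * ?D i / (2 * Im (?w i))) *
       (\<Prod>i\<in>S. \<Prod>j\<in>S - {i}. complex_of_real (cmod ((?w i - ?w j) / (?w i - cnj (?w j))))))
      = (\<Prod>i\<in>S. (cmod (?D i))\<^sup>2 * (1 / (2 * Im (?w i)) * (\<Prod>j\<in>S - {i}. cmod ((?w i - ?w j) / (?w i - cnj (?w j))))))"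
      unfolding prod.distrib[symmetric] prod_norm[symmetric]
      by (intro prod.cong refl) (use Impos SN in \<open>simp add: norm_mult norm_divide prod_norm[symmetric] power2_eq_square less_imp_le\<close>)
    also have "\<dots> = (\<Prod>i\<in>S. exp (- (2 / ?e) * VV \<delta> u0 (kap \<delta> u0 N (Suc i)) (Re z) t) * exp (- (\<Sum>j\<in>S. gg (?w i) (?w j))))"
      using eps by (intro prod.cong refl) (simp add: cmod_Dent_power2 g)
    also have "\<dots> = exp (\<Sum>i\<in>S. - (2 / ?e) * VV \<delta> u0 (kap \<delta> u0 N (Suc i)) (Re z) t + - (\<Sum>j\<in>S. gg (?w i) (?w j)))"
      using fin by (simp only: exp_sum exp_add)
    also have "(\<Sum>i\<in>S. - (2 / ?e) * VV \<delta> u0 (kap \<delta> u0 N (Suc i)) (Re z) t + - (\<Sum>j\<in>S. gg (?w i) (?w j)))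
       = - (2 / ?e) * (\<Sum>i\<in>S. VV \<delta> u0 (kap \<delta> u0 N (Suc i)) (Re z) t) - (\<Sum>i\<in>S. \<Sum>j\<in>S. gg (?w i) (?w j))"
      by (simp only: sum.distrib sum_negf sum_distrib_left[symmetric])
    \<comment> \<open>Matrix indices start at 0 and energies at 1, hence the image under
      \<open>Suc\<close>. The prefactor cancels pi \<epsilon>^2 / 2, so every ordered pair, diagonal
      included, counts once.\<close>
    also have "\<dots> = - 2 / (pi * ?e\<^sup>2) * ENS \<delta> u0 N (Suc ` S) (Re z) t"
      using eps by (simp add: ENS_def sum.reindex field_simps power2_eq_square)
    finally have weight: "cmod ((\<Prod>i\<in>S. ?D i * ?D i / (2 * Im (?w i))) *
       (\<Prod>i\<in>S. \<Prod>j\<in>S - {i}. complex_of_real (cmod ((?w i - ?w j) / (?w i - cnj (?w j)))))) =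
       exp (- 2 / (pi * ?e\<^sup>2) * ENS \<delta> u0 N (Suc ` S) (Re z) t)" .
    have "- 2 / (pi * ?e\<^sup>2) * ENS \<delta> u0 N (Suc ` S) (Re z) t \<le> - 2 / (pi * ?e\<^sup>2) * Emin \<delta> u0 N (Re z) t"
    proof (rule mult_left_mono_neg)
      show "Emin \<delta> u0 N (Re z) t \<le> ENS \<delta> u0 N (Suc ` S) (Re z) t"
        unfolding Emin_def using SN by (intro Min_le) auto
    qed (simp add: divide_nonpos_nonneg)
    then show "cmod ((\<Prod>i\<in>S. ?D i * ?D i / (2 * Im (?w i))) *
       (\<Prod>i\<in>S. \<Prod>j\<in>S - {i}. complex_of_real (cmod ((?w i - ?w j) / (?w i - cnj (?w j)))))) \<le>
       exp (- 2 / (pi * ?e\<^sup>2) * Emin \<delta> u0 N (Re z) t)" unfolding weight by simp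
  qed
  also have "\<dots> = 2 ^ N * exp (- 2 / (pi * ?e\<^sup>2) * Emin \<delta> u0 N (Re z) t)"
    by (simp add: card_Pow)
  finally show ?thesis .
qed

lemma ZN_strip:
  obtains \<Phi> where "continuous_on (strip \<delta> u0 N) \<Phi>"
    "\<And>z. z \<in> strip \<delta> u0 N \<Longrightarrow> ZN \<delta> u0 N z t = of_real (cmod (ZN \<delta> u0 N z t)) * cis (\<Phi> z)"
    "\<And>z. z \<in> strip \<delta> u0 N \<Longrightarrow> 0 < dfun (2 * kmax \<delta> u0 * \<bar>Im z\<bar> / epsN \<delta> u0 N)"
    "\<And>z. z \<in> strip \<delta> u0 N \<Longrightarrow> dfun (2 * kmax \<delta> u0 * \<bar>Im z\<bar> / epsN \<delta> u0 N) ^ N \<le> cmod (ZN \<delta> u0 N z t)"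
    "\<And>z. z \<in> strip \<delta> u0 N \<Longrightarrow> 0 \<le> - (if 0 \<le> Im z then 1 else - 1) * \<Phi> z"
    "\<And>z. z \<in> strip \<delta> u0 N \<Longrightarrow> - (if 0 \<le> Im z then 1 else - 1) * \<Phi> z \<le> N * (2 * kmax \<delta> u0 * \<bar>Im z\<bar> / epsN \<delta> u0 N)"
proof -
  note k = kap[OF \<delta> u sq, of _ N] and Im = Im_zn[OF \<delta> u sq, of _ N]
  note km = kmax_efun[OF \<delta> admissible_max(3)[OF u]]
  have eps: "0 < epsN \<delta> u0 N" using epsN_pos[OF \<delta> u sq N] .
  let ?e = "epsN \<delta> u0 N"
  \<comment> \<open>The weights and the time factor are real and go into d, so the sector bounds are
    uniform in t.\<close>
  define d where "d = (\<lambda>i. sqrt (cn \<delta> u0 N (Suc i)) *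
    exp (- (Im ((zn \<delta> u0 N (Suc i) - complex_of_real (1 / (2 * \<delta>)))\<^sup>2) * t / ?e)))"
  define \<kappa> where "\<kappa> = (\<lambda>i. kap \<delta> u0 N (Suc i) / ?e)"
  define w where "w = (\<lambda>i. zn \<delta> u0 N (Suc i))"
  have D: "Dent \<delta> u0 N (Suc i) z t = of_real (d i) * exp (- of_real (\<kappa> i) * z)" for i z
  proof -
    have "exp (- complex_of_real (kap \<delta> u0 N (Suc i)) * z / ?e
          - complex_of_real (Im ((zn \<delta> u0 N (Suc i) - complex_of_real (1 / (2 * \<delta>)))\<^sup>2) * t / ?e))
      = exp (- of_real (\<kappa> i) * z) * of_real (exp (- (Im ((zn \<delta> u0 N (Suc i) - complex_of_real (1 / (2 * \<delta>)))\<^sup>2) * t / ?e)))"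
      by (simp only: diff_conv_add_uminus exp_add exp_of_real[symmetric] of_real_minus \<kappa>_def of_real_divide minus_mult_left[symmetric] times_divide_eq_left minus_divide_left[symmetric])
    then show ?thesis unfolding Dent_def d_def by (simp only: of_real_mult mult_ac)
  qed
  have ZN: "ZN \<delta> u0 N z t = det (1\<^sub>m N + tauM N d \<kappa> w z)" for z
    unfolding ZN_def D Cent_def
    by (intro arg_cong[where f = det] eq_matI) (auto simp: tauM_def w_def)
  have w: "0 < Im (w i)" if "i < N" for i
    using k(1)[of "Suc i"] Im[of "Suc i"] that by (simp add: w_def)
  have \<kappa>: "0 \<le> \<kappa> i \<and> \<kappa> i \<le> kmax \<delta> u0 / ?e" if "i < N" for i
    using k(1,2)[of "Suc i"] that eps by (simp add: \<kappa>_def divide_right_mono less_imp_le)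
  have K: "0 \<le> kmax \<delta> u0 / ?e" "0 \<le> \<delta> * ?e" "2 * (kmax \<delta> u0 / ?e) * (\<delta> * ?e) < pi"
    using km eps \<delta> by (auto simp: mult_ac)
  obtain \<Phi> where Phi: "continuous_on {z. \<bar>Im z\<bar> \<le> \<delta> * ?e} \<Phi>"
    "\<And>z. z \<in> {z. \<bar>Im z\<bar> \<le> \<delta> * ?e} \<Longrightarrow> ZN \<delta> u0 N z t = of_real (cmod (ZN \<delta> u0 N z t)) * cis (\<Phi> z)"
    "\<And>z. z \<in> {z. \<bar>Im z\<bar> \<le> \<delta> * ?e} \<Longrightarrow> dfun (2 * (kmax \<delta> u0 / ?e) * \<bar>Im z\<bar>) ^ N \<le> cmod (ZN \<delta> u0 N z t)"
    "\<And>z. z \<in> {z. \<bar>Im z\<bar> \<le> \<delta> * ?e} \<Longrightarrow> 0 \<le> - (if 0 \<le> Im z then 1 else - 1) * \<Phi> z"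
    "\<And>z. z \<in> {z. \<bar>Im z\<bar> \<le> \<delta> * ?e} \<Longrightarrow> - (if 0 \<le> Im z then 1 else - 1) * \<Phi> z \<le> N * (2 * (kmax \<delta> u0 / ?e) * \<bar>Im z\<bar>)"
    unfolding ZN by (rule tau_strip[OF w \<kappa> K]) auto
  have eq: "2 * (kmax \<delta> u0 / ?e) * a = 2 * kmax \<delta> u0 * a / ?e" for a by simp
  have S: "{z. \<bar>Im z\<bar> \<le> \<delta> * ?e} = strip \<delta> u0 N" by (simp add: strip_def)
  note Phi = Phi[unfolded S eq]
  show thesis
  proof (rule that[OF Phi(1,2) _ Phi(3,4,5)])
    fix z assume "z \<in> strip \<delta> u0 N"
    then have "2 * (kmax \<delta> u0 / ?e) * \<bar>Im z\<bar> \<le> 2 * (kmax \<delta> u0 / ?e) * (\<delta> * ?e)"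
      using K by (intro mult_left_mono) (auto simp: strip_def)
    from this K(3) have lt: "2 * (kmax \<delta> u0 / ?e) * \<bar>Im z\<bar> < pi" by (rule le_less_trans)
    have "0 \<le> 2 * (kmax \<delta> u0 / ?e) * \<bar>Im z\<bar>"
      by (rule mult_nonneg_nonneg[OF mult_nonneg_nonneg[OF _ K(1)]]) auto
    from dfun_pos[OF this lt] show "0 < dfun (2 * kmax \<delta> u0 * \<bar>Im z\<bar> / ?e)" by simp
  qed
qed

end

theorem mainTheorem3:
  fixes \<delta> :: real and u0 :: "real \<Rightarrow> real" and N :: nat and t :: real and z :: complex
  assumes "0 < \<delta>"
    and "admissible u0"
    and "(\<lambda>x. sqrt (u0 x)) integrable_on UNIV"
    and "1 \<le> N"
    and "\<bar>Im z\<bar> \<le> \<delta> * epsN \<delta> u0 N"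
  shows "0 < (dfun (2 * kmax \<delta> u0 * \<bar>Im z\<bar> / epsN \<delta> u0 N)) ^ N
       \<and> (dfun (2 * kmax \<delta> u0 * \<bar>Im z\<bar> / epsN \<delta> u0 N)) ^ N \<le> cmod (ZN \<delta> u0 N z t)
       \<and> cmod (ZN \<delta> u0 N z t) \<le> 2 ^ N * exp (- 2 / (pi * (epsN \<delta> u0 N)\<^sup>2) * Emin \<delta> u0 N (Re z) t)
       \<and> (\<forall>w\<in>strip \<delta> u0 N. ZN \<delta> u0 N w t \<noteq> 0)
       \<and> (\<forall>x::real. ZN \<delta> u0 N (complex_of_real x) t \<in> \<real> \<and> 0 < Re (ZN \<delta> u0 N (complex_of_real x) t))
       \<and> (\<exists>\<phi>. arg_branch \<delta> u0 N t \<phi>)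
       \<and> (\<forall>\<phi>. arg_branch \<delta> u0 N t \<phi> \<longrightarrow>
            0 \<le> - sgn (Im z) * \<phi> z \<and>
            - sgn (Im z) * \<phi> z \<le> 2 * real N * kmax \<delta> u0 * \<bar>Im z\<bar> / epsN \<delta> u0 N)"
proof -
  note \<delta> = assms(1) and u = assms(2) and sq = assms(3) and N = assms(4) and z = assms(5)
  let ?S = "strip \<delta> u0 N"
  obtain \<Phi> where Phi: "continuous_on ?S \<Phi>"
    "\<And>z. z \<in> ?S \<Longrightarrow> ZN \<delta> u0 N z t = of_real (cmod (ZN \<delta> u0 N z t)) * cis (\<Phi> z)"
    "\<And>z. z \<in> ?S \<Longrightarrow> 0 < dfun (2 * kmax \<delta> u0 * \<bar>Im z\<bar> / epsN \<delta> u0 N)"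
    "\<And>z. z \<in> ?S \<Longrightarrow> dfun (2 * kmax \<delta> u0 * \<bar>Im z\<bar> / epsN \<delta> u0 N) ^ N \<le> cmod (ZN \<delta> u0 N z t)"
    "\<And>z. z \<in> ?S \<Longrightarrow> 0 \<le> - (if 0 \<le> Im z then 1 else - 1) * \<Phi> z"
    "\<And>z. z \<in> ?S \<Longrightarrow> - (if 0 \<le> Im z then 1 else - 1) * \<Phi> z \<le> N * (2 * kmax \<delta> u0 * \<bar>Im z\<bar> / epsN \<delta> u0 N)"
    using ZN_strip[OF \<delta> u sq N] by blast
  have zS: "z \<in> ?S" using z by (simp add: strip_def)
  have eps: "0 < epsN \<delta> u0 N" using epsN_pos[OF \<delta> u sq N] .
  have real_S: "complex_of_real x \<in> ?S" for x
    using eps \<delta> by (simp add: strip_def)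
  \<comment> \<open>The sign in the bounds is 1, not 0, at Im z = 0; both bounds then become 0 and
    squeeze the argument to 0 on the real axis.\<close>
  have Phi_real: "\<Phi> (complex_of_real x) = 0" for x
    using Phi(5,6)[OF real_S[of x]] by simp
  have nz: "ZN \<delta> u0 N v t \<noteq> 0" if "v \<in> ?S" for v
    using zero_less_power[OF Phi(3)[OF that], of N] Phi(4)[OF that] by auto
  have pos: "ZN \<delta> u0 N (complex_of_real x) t = of_real (cmod (ZN \<delta> u0 N (complex_of_real x) t))" for x
    using Phi(2)[OF real_S[of x]] by (simp add: Phi_real)
  have "connected ?S"
  proof -
    have "?S = {z. Im z \<le> \<delta> * epsN \<delta> u0 N} \<inter> {z. Im z \<ge> - (\<delta> * epsN \<delta> u0 N)}"
      by (auto simp: strip_def)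
    then have "convex ?S" by (simp add: convex_Int convex_halfspace_Im_le convex_halfspace_Im_ge)
    then show ?thesis by (rule convex_connected)
  qed
  have branch: "arg_branch \<delta> u0 N t \<Phi>"
    using Phi(1,2) Phi_real by (simp add: arg_branch_def cis_conv_exp)
  \<comment> \<open>Since the determinant does not vanish, two branches differ by multiples of 2 pi.
    The difference is constant on the connected strip and vanishes at 0.\<close>
  have unique: "\<phi> z = \<Phi> z" if \<phi>: "arg_branch \<delta> u0 N t \<phi>" for \<phi>
  proof -
    have "\<phi> z - \<Phi> z = \<phi> (complex_of_real 0) - \<Phi> (complex_of_real 0)"
    proof (rule connected_cis_1_imp_eq[OF \<open>connected ?S\<close> _ _ zS real_S])
      show "continuous_on ?S (\<lambda>z. \<phi> z - \<Phi> z)"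
        using \<phi> Phi(1) by (intro continuous_intros) (simp_all add: arg_branch_def)
      fix v assume v: "v \<in> ?S"
      have "ZN \<delta> u0 N v t = of_real (cmod (ZN \<delta> u0 N v t)) * cis (\<phi> v)"
        using \<phi> v by (simp add: arg_branch_def cis_conv_exp)
      with Phi(2)[OF v] nz[OF v] have "cis (\<phi> v) = cis (\<Phi> v)"
        by (metis mult_cancel_left norm_eq_zero of_real_eq_0_iff)
      then show "cis (\<phi> v - \<Phi> v) = 1" by (simp add: cis_divide[symmetric])
    qed
    then show ?thesis using \<phi> Phi_real[of 0] by (simp add: arg_branch_def del: of_real_0)
  qed
  have bound: "0 \<le> - sgn (Im z) * \<phi> z \<and>
      - sgn (Im z) * \<phi> z \<le> 2 * real N * kmax \<delta> u0 * \<bar>Im z\<bar> / epsN \<delta> u0 N"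
    if "arg_branch \<delta> u0 N t \<phi>" for \<phi>
    unfolding unique[OF that] using Phi(5,6)[OF zS]
    by (auto simp: sgn_if mult_ac split: if_splits)
  have real_pos: "ZN \<delta> u0 N (complex_of_real x) t \<in> \<real> \<and> 0 < Re (ZN \<delta> u0 N (complex_of_real x) t)" for x
  proof
    show "ZN \<delta> u0 N (complex_of_real x) t \<in> \<real>" by (subst pos) simp
    show "0 < Re (ZN \<delta> u0 N (complex_of_real x) t)" using nz[OF real_S[of x]] by (subst pos) simp
  qed
  show ?thesis
    using zero_less_power[OF Phi(3)[OF zS], of N] Phi(4)[OF zS] ZN_upper_bound[OF \<delta> u sq N] nz real_pos branch bound
    by blast
qed

end
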